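(* Consider quadruples of points $\{P_1,P_2,P_3,P_4\}\subset\mathbb{R}^3$ that are generic (as defined in the context). Up to combinatorial equivalence of their Morse posets there are exactly nine generic tetrahedra, and they are uniquely described by the following nine types: $$(4,6,4,1),\quad (4,6,3,0),\quad (4,5,3,1),\quad (4,5,2,0),\quad (4,4,2,1)\,O,\quad (4,4,1,0)\,O,\quad (4,4,1,0)\,P,\quad (4,3,0,0)\,L,\quad (4,3,0,0)\,T.$$ That is: every generic quadruple has exactly one of these nine types; each of the nine types is the type of some generic quadruple; and two generic quadruples are combinatorially equivalent if and only if they have the same type.
   Context: Let $P_1,P_2,P_3,P_4$ be points of $\mathbb{R}^3$ and let $d(\cdot,\cdot)$ be the Euclidean distance. For pairwise different indices, $P_{ij}$ is the midpoint of the segment $P_iP_j$, $P_{ijk}$ is the center of the circumscribed circle of the triangle $P_iP_jP_k$ (the circle in the plane of the triangle), $P_{1234}$ is the center of the circumscribed sphere of the tetrahedron, and $\mathbb{T}$ is the convex hull of $\{P_1,P_2,P_3,P_4\}$. By $P_iP_j$ and $P_iP_jP_k$ we mean the closed segment and the closed (solid) triangle. Generic: the quadruple is called generic if the convex hull of $P_1,\dots,P_4$ is $3$-dimensional, no point $P_{ijk}$ lies on one of the edges of the triangle $P_iP_jP_k$, and $P_{1234}$ does not lie in one of the planes of the triangles $P_iP_jP_k$. Let $V_i=\{X\in\mathbb{R}^3 : d(X,P_i)\le d(X,P_k)\text{ for all }k\}$, $V_{ij}=V_i\cap V_j$ and $V_{ijk}=V_i\cap V_j\cap V_k$ (different indices).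 Active subsets of $\{P_1,P_2,P_3,P_4\}$: every one-point subset $\{P_i\}$ is active; $\{P_i,P_j\}$ is active iff $V_{ij}\cap P_iP_j=\{P_{ij}\}$; $\{P_i,P_j,P_k\}$ is active iff $V_{ijk}\cap P_iP_jP_k=\{P_{ijk}\}$; $\{P_1,P_2,P_3,P_4\}$ is active iff $P_{1234}\in\mathbb{T}$. (These are exactly the subsets corresponding to critical points of the function $X\mapsto\min_j d(X,P_j)$.) The Morse poset is the set of active subsets, partially ordered by inclusion. Two generic quadruples are combinatorially equivalent if there is a bijection between the two point sets that sends the active subsets of one onto the active subsets of the other. The Gabriel graph of the quadruple has vertices $P_1,\dots,P_4$ and an edge between $P_i$ and $P_j$ exactly when the ball having the segment $P_iP_j$ as diameter contains no other point of the quadruple; equivalently, its edges are the active two-point subsets. Type: for a generic quadruple let $a_k$ be the number of active subsets with $k+1$ elements, $k=0,1,2,3$. Its type is the tuple $(a_0,a_1,a_2,a_3)$ together with, when $a_1\in\{3,4\}$, a letter recording the isomorphism class of the Gabriel graph: $O$ means a cycle on $4$ vertices, $P$ means a triangle with one additional pendant edge to the fourth vertex, $L$ means a path on $4$ vertices, $T$ means a star with one vertex joined to each of the three others. When $a_1=6$ or $a_1=5$ the Gabriel graph is the complete graph on $4$ vertices, respectively the complete graph minus one edge, and no letter is needed. *)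

theory Defs
  imports "HOL-Analysis.Analysis"
begin

type_synonym point = "real ^ 3"

text \<open>
  A quadruple is represented by its point set \<open>S\<close> with \<open>card S = 4\<close>; this loses nothing, since
  the points of a generic quadruple are distinct.
\<close>

text \<open>
  The centre of the circle, resp. sphere, circumscribed to an affinely independent set of three,
  resp. four, points. For three points the affine hull is the plane of the triangle; for four it is
  the whole space.
\<close>

definition circumcenter :: "point set \<Rightarrow> point" where
  "circumcenter A = (THE X. X \<in> affine hull A \<and> (\<exists>r. A \<subseteq> sphere X r))"

definition generic :: "point set \<Rightarrow> bool" where
  "generic S \<longleftrightarrow>
     card S = 4 \<and>
     aff_dim (convex hull S) = 3 \<and>
     (\<forall>A. A \<subseteq> S \<and> card A = 3 \<longrightarrow>
        (\<forall>p\<in>A. \<forall>q\<in>A. p \<noteq> q \<longrightarrow> circumcenter A \<notin> closed_segment p q)) \<and>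
     (\<forall>A. A \<subseteq> S \<and> card A = 3 \<longrightarrow> circumcenter S \<notin> affine hull A)"

definition voronoi_cell :: "point set \<Rightarrow> point \<Rightarrow> point set" where
  "voronoi_cell S p = {X. \<forall>q\<in>S. dist X p \<le> dist X q}"

text \<open>The sets \<open>V\<^sub>i\<^sub>j\<close> and \<open>V\<^sub>i\<^sub>j\<^sub>k\<close> are \<open>voronoi_face S A\<close> for two- and three-point sets \<open>A\<close>.\<close>

definition voronoi_face :: "point set \<Rightarrow> point set \<Rightarrow> point set" where
  "voronoi_face S A = (\<Inter>p\<in>A. voronoi_cell S p)"

definition active :: "point set \<Rightarrow> point set \<Rightarrow> bool" where
  "active S A \<longleftrightarrow> A \<subseteq> S \<and>
     ((\<exists>p. A = {p}) \<or>
      (\<exists>p q. p \<noteq> q \<and> A = {p, q} \<and> voronoi_face S A \<inter> closed_segment p q = {midpoint p q}) \<or>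
      (card A = 3 \<and> voronoi_face S A \<inter> convex hull A = {circumcenter A}) \<or>
      (card A = 4 \<and> A = S \<and> circumcenter S \<in> convex hull S))"

text \<open>The carrier of the Morse poset; its order is \<open>\<subseteq>\<close>.\<close>

definition morse_poset :: "point set \<Rightarrow> point set set" where
  "morse_poset S = {A. active S A}"

definition combinatorially_equivalent :: "point set \<Rightarrow> point set \<Rightarrow> bool" where
  "combinatorially_equivalent S S' \<longleftrightarrow>
     (\<exists>f. bij_betw f S S' \<and> (\<lambda>A. f ` A) ` morse_poset S = morse_poset S')"

text \<open>
  The ball is taken closed. For a generic quadruple the open ball gives the same graph: a third
  point \<open>P\<^sub>k\<close> on the boundary sphere would make \<open>P\<^sub>i\<^sub>j\<^sub>k\<close> the midpoint of \<open>P\<^sub>iP\<^sub>j\<close>.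
\<close>

definition gabriel_edges :: "point set \<Rightarrow> point set set" where
  "gabriel_edges S = {{p, q} | p q. p \<in> S \<and> q \<in> S \<and> p \<noteq> q \<and>
     cball (midpoint p q) (dist p q / 2) \<inter> S = {p, q}}"

datatype graph_letter = Cycle_O | Paw_P | Path_L | Star_T

text \<open>Representatives, on the vertex set \<open>{1..4}\<close>, of the isomorphism classes of graphs that have
  a letter.\<close>

fun letter_edges :: "graph_letter \<Rightarrow> nat set set" where
  "letter_edges Cycle_O = {{1, 2}, {2, 3}, {3, 4}, {4, 1}}"
| "letter_edges Paw_P = {{1, 2}, {2, 3}, {3, 1}, {3, 4}}"
| "letter_edges Path_L = {{1, 2}, {2, 3}, {3, 4}}"
| "letter_edges Star_T = {{1, 2}, {1, 3}, {1, 4}}"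

definition gabriel_letter :: "point set \<Rightarrow> graph_letter \<Rightarrow> bool" where
  "gabriel_letter S l \<longleftrightarrow>
     (\<exists>f. bij_betw f {1..4} S \<and> (\<lambda>e. f ` e) ` letter_edges l = gabriel_edges S)"

definition num_active :: "point set \<Rightarrow> nat \<Rightarrow> nat" where
  "num_active S k = card {A \<in> morse_poset S. card A = k + 1}"

type_synonym tetrahedron_type = "(nat \<times> nat \<times> nat \<times> nat) \<times> graph_letter option"

text \<open>
  Having a type is a relation rather than a function, because a priori the Gabriel graph could be
  one without a letter (a triangle and an isolated vertex); such a quadruple has no type.
\<close>

definition has_type :: "point set \<Rightarrow> tetrahedron_type \<Rightarrow> bool" where
  "has_type S \<tau> \<longleftrightarrow>
     fst \<tau> = (num_active S 0, num_active S 1, num_active S 2, num_active S 3) \<and>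
     (if num_active S 1 \<in> {3, 4} then \<exists>l. snd \<tau> = Some l \<and> gabriel_letter S l
      else snd \<tau> = None)"

definition nine_types :: "tetrahedron_type set" where
  "nine_types =
     {((4, 6, 4, 1), None),
      ((4, 6, 3, 0), None),
      ((4, 5, 3, 1), None),
      ((4, 5, 2, 0), None),
      ((4, 4, 2, 1), Some Cycle_O),
      ((4, 4, 1, 0), Some Cycle_O),
      ((4, 4, 1, 0), Some Paw_P),
      ((4, 3, 0, 0), Some Path_L),
      ((4, 3, 0, 0), Some Star_T)}"

end

(* Let U be the squared distances between the vertices, R the radius of the circumsphere and l the
   barycentric coordinates of its centre. An edge is active iff it is not opposite to an obtuse
   angle, a face pqr is active iff it is acute and l(s) > 0, and the whole set is active iff all
   l are positive. So the Morse poset is determined by which face angles are obtuse and by the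
   signs of l. Everything that is needed about these signs follows from the linear relations
   sum_y l(y) U(x,y) = 2 R^2 for each vertex x, from U(x,y) < 4 R^2, and from the fact that no
   |l(x)| exceeds the sum of the others, since the vertices are at the same distance from the
   centre. As shortest edges across cuts are active, the Gabriel graph is connected, and for each
   of the six connected graphs with at least three edges the sign relations leave only the listed
   posets. *)

theory Submission
  imports Defs
begin

section \<open>Circumcenters\<close>

text \<open>Genericity excludes right angles in the faces and zero coordinates, so activity becomes
  a Boolean function of twelve angles and four signs. The obstacle is that an inactive edge makes
  only one of its two faces obtuse for certain; whether the other face is active must be read off
  the signs. The relation \<open>obtuse_opposite_edge\<close> settles the complete graph and the
  cycle. The diamond also uses \<open>obtuse_neighbour\<close>, the one place where the bound on
  |l(x)| enters; paw, path and star use \<open>not_both_obtuse\<close>. Counts and graph do not by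
  themselves give an equivalence of posets, so every case ends in an explicit family of subsets of
  {1, 2, 3, 4}, from which both the type and the equivalence class are obtained.\<close>

lemma circumcenter_unique:
  assumes "X \<in> affine hull A" "A \<subseteq> sphere X r" "Y \<in> affine hull A" "A \<subseteq> sphere Y r'"
  shows "X = (Y::point)"
proof -
  let ?k = "((norm X)\<^sup>2 - (norm Y)\<^sup>2 - r\<^sup>2 + r'\<^sup>2) / 2"
  \<comment> \<open>Subtracting |X - z|^2 = r^2 and |Y - z|^2 = r'^2 cancels the square of z. So the
    functional given by X - Y is constant on A, hence on its affine hull, which contains both
    centres.\<close>
  have "(X - Y) \<bullet> z = ?k" if "z \<in> A" for z
  proof -
    have "norm (X - z) = r" "norm (Y - z) = r'"
      using that assms(2,4) by (auto simp: dist_norm)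
    then have "(X - z) \<bullet> (X - z) = r\<^sup>2" "(Y - z) \<bullet> (Y - z) = r'\<^sup>2"
      by (auto simp: dot_square_norm)
    then show ?thesis
      by (simp add: power2_norm_eq_inner inner_diff_left inner_diff_right inner_commute algebra_simps)
  qed
  then have "affine hull A \<subseteq> {z. (X - Y) \<bullet> z = ?k}"
    by (intro hull_minimal affine_hyperplane) auto
  then have "(X - Y) \<bullet> X = ?k" "(X - Y) \<bullet> Y = ?k"
    using assms(1,3) by blast+
  then have "(X - Y) \<bullet> (X - Y) = 0"
    by (simp add: inner_diff_right)
  then show ?thesis by simp
qed

lemma circumcenter_eqI:
  assumes "X \<in> affine hull A" "A \<subseteq> sphere X r"
  shows "circumcenter A = X"
  unfolding circumcenter_def
  by (rule the_equality) (use assms circumcenter_unique in blast)+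

text \<open>Equidistance from p and z is the linear equation 2 (z - p) . X = |z|^2 - |p|^2. Three of
  them form a square system on \<open>real ^ 3\<close>. Its kernel is trivial: a vector orthogonal
  to all differences is constant on the affine hull, which is the whole space.\<close>

lemma circumcenter_exists:
  assumes "affine hull A = (UNIV :: point set)" "A = {p, q, r, s}"
  shows "\<exists>X R. A \<subseteq> sphere X R"
proof -
  define d where "d = (\<lambda>i::3. if i = 1 then q - p else if i = 2 then r - p else s - p)"
  define k where "k = (\<lambda>i::3. if i = 1 then (norm q)\<^sup>2 - (norm p)\<^sup>2 else if i = 2 then (norm r)\<^sup>2 - (norm p)\<^sup>2
     else (norm s)\<^sup>2 - (norm p)\<^sup>2)"
  define f where "f = (\<lambda>x::point. (\<chi> i. d i \<bullet> x) :: point)"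
  have lin: "linear f"
    by (rule linearI) (auto simp: f_def vec_eq_iff inner_add_right)
  have "x = 0" if "f x = 0" for x
  proof -
    have "d i \<bullet> x = 0" for i
      using that by (auto simp: f_def vec_eq_iff)
    from this[of 1] this[of 2] this[of 3]
    have "x \<bullet> q = x \<bullet> p" "x \<bullet> r = x \<bullet> p" "x \<bullet> s = x \<bullet> p"
      by (auto simp: d_def inner_diff_left inner_diff_right inner_commute)
    then have "affine hull A \<subseteq> {z. x \<bullet> z = x \<bullet> p}"
      using assms(2) by (intro hull_minimal affine_hyperplane) auto
    then have "x \<bullet> (p + x) = x \<bullet> p"
      using assms(1) by blast
    then show ?thesis
      by (simp add: inner_add_right)
  qed
  then have "inj f"
    using lin linear_injective_0 by blast
  then have "surj f"
    using lin linear_injective_imp_surjective by blast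
  then obtain x where x: "f x = (\<chi> i. k i)"
    by (metis surjD)
  have "d i \<bullet> x = k i" for i
    using x by (auto simp: f_def vec_eq_iff)
  from this[of 1] this[of 2] this[of 3]
  have e: "(q - p) \<bullet> x = (norm q)\<^sup>2 - (norm p)\<^sup>2" "(r - p) \<bullet> x = (norm r)\<^sup>2 - (norm p)\<^sup>2"
    "(s - p) \<bullet> x = (norm s)\<^sup>2 - (norm p)\<^sup>2"
    by (auto simp: d_def k_def)
  \<comment> \<open>The factor 2 was left out of the system, so \<open>x\<close> is twice the
    centre.\<close>
  have *: "dist (x /\<^sub>R 2) z = dist (x /\<^sub>R 2) p" if "(z - p) \<bullet> x = (norm z)\<^sup>2 - (norm p)\<^sup>2" for z
  proof -
    have d: "(dist (x /\<^sub>R 2) z)\<^sup>2 = x \<bullet> x / 4 - z \<bullet> x + z \<bullet> z" for z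
      unfolding dist_norm power2_norm_eq_inner
      by (simp add: inner_diff_left inner_diff_right inner_commute)
    have "z \<bullet> x - p \<bullet> x = z \<bullet> z - p \<bullet> p"
      using that by (simp add: inner_diff_left power2_norm_eq_inner)
    then have "(dist (x /\<^sub>R 2) z)\<^sup>2 = (dist (x /\<^sub>R 2) p)\<^sup>2"
      unfolding d by linarith
    then show ?thesis by simp
  qed
  have "A \<subseteq> sphere (x /\<^sub>R 2) (dist (x /\<^sub>R 2) p)"
    unfolding assms(2) using *[OF e(1)] *[OF e(2)] *[OF e(3)] by simp
  then show ?thesis by blast
qed

text \<open>The vertex of the angle is the first argument. Right angles count as not obtuse; in a
  generic quadruple they do not occur.\<close>

definition obtuse :: "point \<Rightarrow> point \<Rightarrow> point \<Rightarrow> bool" where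
  "obtuse r p q \<longleftrightarrow> (p - r) \<bullet> (q - r) < 0"

text \<open>For generic \<open>S\<close> the choice is unique on \<open>S\<close>, by
  \<open>bary_unique\<close>.\<close>

definition bary :: "point set \<Rightarrow> point \<Rightarrow> real" where
  "bary S = (SOME l. sum l S = 1 \<and> (\<Sum>x\<in>S. l x *\<^sub>R x) = circumcenter S)"

lemma obtuse_commute: "obtuse r p q \<longleftrightarrow> obtuse r q p"
  by (simp add: obtuse_def inner_commute)

lemma two_inner_dist: "2 * ((p - r) \<bullet> (q - r)) = (dist p r)\<^sup>2 + (dist q r)\<^sup>2 - (dist p q)\<^sup>2"
  for p q r :: "'a::real_inner"
  unfolding dist_norm power2_norm_eq_inner
  by (simp add: inner_diff_left inner_diff_right inner_commute)

lemma obtuse_dist: "obtuse r p q \<longleftrightarrow> (dist p r)\<^sup>2 + (dist q r)\<^sup>2 < (dist p q)\<^sup>2"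
  using two_inner_dist[of p r q] by (auto simp: obtuse_def)

text \<open>Adding the two inequalities between squared sides leaves
  \<open>2 * (dist p r)\<^sup>2 < 0\<close>.\<close>

lemma not_obtuse_twice:
  assumes "obtuse r p q"
  shows "\<not> obtuse p q r"
  using assms zero_le_power2[of "dist p r"] unfolding obtuse_dist dist_commute[of q p] dist_commute[of r p] dist_commute[of r q]
  by linarith

text \<open>The weights are the numbers \<open>sin 2A\<close> up to a common factor.\<close>

lemma circumcenter_triangle:
  fixes p q r :: point
  assumes indep: "\<not> affine_dependent {p, q, r}" and "card {p, q, r} = 3"
  obtains w where "w > 0"
    "circumcenter {p, q, r} = ((dist q r)\<^sup>2 * ((q - p) \<bullet> (r - p)) * w) *\<^sub>R p
      + ((dist p r)\<^sup>2 * ((p - q) \<bullet> (r - q)) * w) *\<^sub>R q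
      + ((dist p q)\<^sup>2 * ((p - r) \<bullet> (q - r)) * w) *\<^sub>R r"
    "(dist q r)\<^sup>2 * ((q - p) \<bullet> (r - p)) * w + (dist p r)\<^sup>2 * ((p - q) \<bullet> (r - q)) * w
      + (dist p q)\<^sup>2 * ((p - r) \<bullet> (q - r)) * w = 1"
    "dist (circumcenter {p, q, r}) q = dist (circumcenter {p, q, r}) p"
    "dist (circumcenter {p, q, r}) r = dist (circumcenter {p, q, r}) p"
proof -
  have ne: "p \<noteq> q" "p \<noteq> r" "q \<noteq> r"
    using assms(2) by (auto simp: card_insert_if split: if_splits)
  define a b where "a = q - p" and "b = r - p"
  \<comment> \<open>\<open>g\<close> is the Gram determinant of \<open>a\<close> and
    \<open>b\<close>. The vector \<open>v\<close> is \<open>a \<bullet> a\<close> times the part of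
    \<open>b\<close> orthogonal to \<open>a\<close>, so its square is
    \<open>(a \<bullet> a) * g\<close>.\<close>
  define g where "g = (a \<bullet> a) * (b \<bullet> b) - (a \<bullet> b)\<^sup>2"
  define v where "v = (a \<bullet> a) *\<^sub>R b - (a \<bullet> b) *\<^sub>R a"
  have "v \<noteq> 0"
  proof
    assume "v = 0"
    \<comment> \<open>The coefficients of \<open>v\<close> at r and q, completed at p to sum zero: a
      vanishing \<open>v\<close> is an affine relation.\<close>
    let ?U = "\<lambda>x. if x = r then a \<bullet> a else if x = q then - (a \<bullet> b) else (a \<bullet> b) - (a \<bullet> a)"
    have "sum ?U {p, q, r} = 0" using ne by auto
    moreover have "(\<Sum>x\<in>{p, q, r}. ?U x *\<^sub>R x) = v"
      using ne by (simp add: v_def a_def b_def algebra_simps)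
    moreover have "?U r \<noteq> 0" using ne by (simp add: a_def)
    ultimately have "affine_dependent {p, q, r}"
      using \<open>v = 0\<close> by (subst affine_dependent_explicit_finite) auto
    then show False using indep by simp
  qed
  have "v \<bullet> v = (a \<bullet> a) * g"
    by (simp add: v_def g_def inner_diff_left inner_diff_right inner_commute power2_eq_square algebra_simps)
  moreover have "v \<bullet> v > 0" "a \<bullet> a > 0"
    using \<open>v \<noteq> 0\<close> ne by (auto simp: a_def)
  ultimately have g: "g > 0"
    by (simp add: zero_less_mult_iff)
  define w where "w = 1 / (2 * g)"
  have w: "w > 0" "2 * g * w = 1" using g by (auto simp: w_def)
  \<comment> \<open>Cramer's rule for c - p = k a + l b with
    \<open>(c - p) \<bullet> a = a \<bullet> a / 2\<close> and
    \<open>(c - p) \<bullet> b = b \<bullet> b / 2\<close>; the factor 1/2 sits in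
    \<open>w\<close>.\<close>
  define k l where "k = (b \<bullet> b) * (a \<bullet> a - a \<bullet> b) * w" and "l = (a \<bullet> a) * (b \<bullet> b - a \<bullet> b) * w"
  define c where "c = p + k *\<^sub>R a + l *\<^sub>R b"
  have ka: "k * (a \<bullet> a) + l * (a \<bullet> b) = (a \<bullet> a) / 2"
  proof -
    have "k * (a \<bullet> a) + l * (a \<bullet> b) = (a \<bullet> a) * (g * w)"
      by (simp add: k_def l_def g_def power2_eq_square algebra_simps)
    then show ?thesis using w by (simp add: field_simps)
  qed
  have lb: "k * (a \<bullet> b) + l * (b \<bullet> b) = (b \<bullet> b) / 2"
  proof -
    have "k * (a \<bullet> b) + l * (b \<bullet> b) = (b \<bullet> b) * (g * w)"
      by (simp add: k_def l_def g_def power2_eq_square algebra_simps)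
    then show ?thesis using w by (simp add: field_simps)
  qed
  have cq: "dist c q = dist c p"
  proof -
    have e: "c - q = (k - 1) *\<^sub>R a + l *\<^sub>R b" "c - p = k *\<^sub>R a + l *\<^sub>R b"
      by (simp_all add: c_def a_def b_def algebra_simps)
    have "(dist c q)\<^sup>2 - (dist c p)\<^sup>2 = a \<bullet> a - 2 * (k * (a \<bullet> a) + l * (a \<bullet> b))"
      unfolding dist_norm power2_norm_eq_inner e
      by (simp add: inner_add_left inner_add_right inner_commute algebra_simps)
    then show ?thesis using ka by simp
  qed
  have cr: "dist c r = dist c p"
  proof -
    have e: "c - r = k *\<^sub>R a + (l - 1) *\<^sub>R b" "c - p = k *\<^sub>R a + l *\<^sub>R b"
      by (simp_all add: c_def a_def b_def algebra_simps)
    have "(dist c r)\<^sup>2 - (dist c p)\<^sup>2 = b \<bullet> b - 2 * (k * (a \<bullet> b) + l * (b \<bullet> b))"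
      unfolding dist_norm power2_norm_eq_inner e
      by (simp add: inner_add_left inner_add_right inner_commute algebra_simps)
    then show ?thesis using lb by simp
  qed
  have inn: "(dist q r)\<^sup>2 = a \<bullet> a + b \<bullet> b - 2 * (a \<bullet> b)" "(dist p r)\<^sup>2 = b \<bullet> b" "(dist p q)\<^sup>2 = a \<bullet> a"
    "(q - p) \<bullet> (r - p) = a \<bullet> b" "(p - q) \<bullet> (r - q) = a \<bullet> a - a \<bullet> b"
    "(p - r) \<bullet> (q - r) = b \<bullet> b - a \<bullet> b"
    unfolding dist_norm power2_norm_eq_inner a_def b_def
    by (simp_all add: inner_diff_left inner_diff_right inner_commute algebra_simps)
  have sum: "(dist q r)\<^sup>2 * ((q - p) \<bullet> (r - p)) * w + k + l = 1"
  proof -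
    have "(dist q r)\<^sup>2 * ((q - p) \<bullet> (r - p)) * w + k + l = 2 * g * w"
      unfolding inn k_def l_def g_def by (simp add: power2_eq_square algebra_simps)
    then show ?thesis using w by simp
  qed
  then have e: "(dist q r)\<^sup>2 * ((q - p) \<bullet> (r - p)) * w = 1 - k - l" by simp
  have c: "c = (1 - k - l) *\<^sub>R p + k *\<^sub>R q + l *\<^sub>R r"
    by (simp add: c_def a_def b_def algebra_simps)
  have "c \<in> affine hull {p, q, r}"
  proof -
    have "(1 - k - l) + k + l = 1" by simp
    then show ?thesis unfolding affine_hull_3 using c by blast
  qed
  moreover have "{p, q, r} \<subseteq> sphere c (dist c p)"
    using cq cr by auto
  ultimately have cc: "circumcenter {p, q, r} = c"
    by (rule circumcenter_eqI)
  have kl: "(dist p r)\<^sup>2 * ((p - q) \<bullet> (r - q)) * w = k" "(dist p q)\<^sup>2 * ((p - r) \<bullet> (q - r)) * w = l"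
    unfolding inn k_def l_def by simp_all
  show ?thesis
  proof (rule that[OF w(1)])
    show "dist (circumcenter {p, q, r}) q = dist (circumcenter {p, q, r}) p"
      unfolding cc by (rule cq)
    show "dist (circumcenter {p, q, r}) r = dist (circumcenter {p, q, r}) p"
      unfolding cc by (rule cr)
  qed (unfold cc kl e, rule c, simp)
qed

section \<open>Barycentric coordinates of the circumcenter and activity\<close>

text \<open>Points of the Voronoi face are equidistant from the points of \<open>A\<close>, and in
  the affine hull of \<open>A\<close> only the circumcenter is. So the intersection is at most
  \<open>{c}\<close>. In the uses \<open>K\<close> is a segment or a triangle.\<close>

lemma voronoi_face_inter:
  assumes "A \<subseteq> S" "A \<noteq> {}" and c: "c \<in> affine hull A" "A \<subseteq> sphere c \<rho>" and K: "K \<subseteq> affine hull A"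
  shows "voronoi_face S A \<inter> K = {c} \<longleftrightarrow> c \<in> K \<and> (\<forall>x\<in>S. \<rho> \<le> dist c x)"
proof -
  have "X = c" if X: "X \<in> voronoi_face S A \<inter> K" for X
  proof -
    obtain a where a: "a \<in> A" using assms(2) by blast
    have "dist X x \<le> dist X y" if "x \<in> A" "y \<in> A" for x y
      using X that assms(1) unfolding voronoi_face_def voronoi_cell_def by blast
    then have "dist X x = dist X a" if "x \<in> A" for x
      using that a by (intro antisym) auto
    then have "A \<subseteq> sphere X (dist X a)" by auto
    then show ?thesis using circumcenter_unique[OF _ _ c] X K by blast
  qed
  moreover have "c \<in> voronoi_face S A \<longleftrightarrow> (\<forall>x\<in>S. \<rho> \<le> dist c x)"
  proof -
    have "dist c x = \<rho>" if "x \<in> A" for x using c(2) that by auto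
    then show ?thesis using assms(2) unfolding voronoi_face_def voronoi_cell_def by auto
  qed
  ultimately show ?thesis by blast
qed

text \<open>The sign of the inner product tells on which side of the sphere with diameter pq the
  point r lies.\<close>

lemma dist_midpoint_inner:
  "(dist (midpoint p q) r)\<^sup>2 = (dist p q / 2)\<^sup>2 + (p - r) \<bullet> (q - r)" for p q r :: "'a::real_inner"
  unfolding dist_norm power_divide power2_norm_eq_inner midpoint_def
  by (simp add: inner_diff_left inner_diff_right inner_add_left inner_add_right inner_commute field_simps)

lemma card_four:
  assumes "card {p, q, r, s} = 4"
  shows "distinct [p, q, r, s]"
  using assms by (auto simp: card_insert_if split: if_splits)

section \<open>Consequences of genericity for the coordinates of the circumcenter\<close>

lemma generic_finite: "generic S \<Longrightarrow> finite S"
  by (metis card.infinite generic_def zero_neq_numeral)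

lemma generic_indep:
  assumes "generic S"
  shows "\<not> affine_dependent S"
  using assms generic_finite[OF assms] by (auto simp: generic_def affine_independent_iff_card aff_dim_convex_hull)

lemma generic_affine_hull:
  assumes "generic S"
  shows "affine hull S = UNIV"
  using assms by (simp add: generic_def aff_dim_convex_hull flip: aff_dim_eq_full)

lemma generic_circumsphere:
  assumes "generic S"
  obtains R where "S \<subseteq> sphere (circumcenter S) R" "R > 0"
proof -
  have "card S = 4" using assms by (simp add: generic_def)
  then obtain p q r s where S: "S = {p, q, r, s}"
    by (auto simp: numeral_eq_Suc card_Suc_eq)
  then obtain X R where X: "S \<subseteq> sphere X R"
    using circumcenter_exists[OF generic_affine_hull[OF assms]] by blast
  then have c: "circumcenter S = X"
    using generic_affine_hull[OF assms] by (intro circumcenter_eqI) auto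
  have "p \<noteq> q" using \<open>card S = 4\<close> card_four[of p q r s] S by simp
  moreover have "dist X p = R" "dist X q = R" using S X by auto
  ultimately have "R > 0" by (metis dist_nz dist_self)
  then show ?thesis using that X c by blast
qed

lemma bary:
  assumes "generic S"
  shows "sum (bary S) S = 1" "(\<Sum>x\<in>S. bary S x *\<^sub>R x) = circumcenter S"
proof -
  have "circumcenter S \<in> affine hull S" using generic_affine_hull[OF assms] by simp
  then have "\<exists>l. sum l S = 1 \<and> (\<Sum>x\<in>S. l x *\<^sub>R x) = circumcenter S"
    unfolding affine_hull_finite[OF generic_finite[OF assms]] by blast
  then have "sum (bary S) S = 1 \<and> (\<Sum>x\<in>S. bary S x *\<^sub>R x) = circumcenter S"
    unfolding bary_def by (rule someI_ex)
  then show "sum (bary S) S = 1" "(\<Sum>x\<in>S. bary S x *\<^sub>R x) = circumcenter S" by auto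
qed

lemma affine_coordinates_unique:
  assumes "\<not> affine_dependent A" "finite A" "sum l A = sum m A" "(\<Sum>x\<in>A. l x *\<^sub>R x) = (\<Sum>x\<in>A. m x *\<^sub>R x)" "x \<in> A"
  shows "l x = m x"
proof (rule ccontr)
  assume "l x \<noteq> m x"
  moreover have "sum (\<lambda>x. l x - m x) A = 0" "(\<Sum>x\<in>A. (l x - m x) *\<^sub>R x) = 0"
    using assms(3,4) by (simp_all add: sum_subtractf scaleR_left_diff_distrib)
  ultimately have "affine_dependent A"
    unfolding affine_dependent_explicit_finite[OF assms(2)]
    using assms(5) by (intro exI[of _ "\<lambda>x. l x - m x"]) auto
  then show False using assms(1) by blast
qed

lemma bary_unique:
  assumes "generic S" "sum l S = 1" "(\<Sum>x\<in>S. l x *\<^sub>R x) = circumcenter S" "x \<in> S"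
  shows "bary S x = l x"
  by (rule affine_coordinates_unique[OF generic_indep[OF assms(1)] generic_finite[OF assms(1)] _ _ assms(4)])
    (simp_all only: bary[OF assms(1)] assms(2,3))

text \<open>A vanishing coordinate would put the circumcenter into the plane of the opposite
  face.\<close>

lemma bary_nonzero:
  assumes "generic S" "x \<in> S"
  shows "bary S x \<noteq> 0"
proof
  assume 0: "bary S x = 0"
  note fin = generic_finite[OF assms(1)]
  have "sum (bary S) (S - {x}) = 1" "(\<Sum>y\<in>S - {x}. bary S y *\<^sub>R y) = circumcenter S"
    using bary[OF assms(1)] 0 sum.remove[OF fin assms(2), of "bary S"]
      sum.remove[OF fin assms(2), of "\<lambda>y. bary S y *\<^sub>R y"] by auto
  then have "circumcenter S \<in> affine hull (S - {x})"
    unfolding affine_hull_finite[OF finite_Diff[OF fin]] by blast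
  moreover have "card (S - {x}) = 3" "S - {x} \<subseteq> S"
    using assms fin by (auto simp: generic_def)
  ultimately show False using assms(1) unfolding generic_def by blast
qed

text \<open>Membership in the hull gives nonnegative coordinates; strictness comes from
  \<open>bary_nonzero\<close>.\<close>

lemma circumcenter_in_hull_iff:
  assumes "generic S"
  shows "circumcenter S \<in> convex hull S \<longleftrightarrow> (\<forall>x\<in>S. bary S x > 0)"
proof
  assume "circumcenter S \<in> convex hull S"
  then obtain l where "\<forall>x\<in>S. 0 \<le> l x" "sum l S = 1" "(\<Sum>x\<in>S. l x *\<^sub>R x) = circumcenter S"
    unfolding convex_hull_finite[OF generic_finite[OF assms]] by blast
  then show "\<forall>x\<in>S. bary S x > 0"
    using bary_unique[OF assms, of l] bary_nonzero[OF assms] by fastforce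
next
  assume "\<forall>x\<in>S. bary S x > 0"
  then show "circumcenter S \<in> convex hull S"
    unfolding convex_hull_finite[OF generic_finite[OF assms]]
    using bary[OF assms] by (auto intro!: exI[of _ "bary S"] less_imp_le)
qed

text \<open>With c the circumcenter, the squared distance of x and y is 2 R^2 - 2 (x - c) . (y - c).
  Averaging over y with the barycentric weights removes the inner products, because the weighted sum
  of the y - c is zero.\<close>

lemma bary_row:
  assumes "generic S" "S \<subseteq> sphere (circumcenter S) R" "x \<in> S"
  shows "(\<Sum>y\<in>S. bary S y * (dist x y)\<^sup>2) = 2 * R\<^sup>2"
proof -
  let ?c = "circumcenter S"
  have *: "(dist x y)\<^sup>2 = 2 * R\<^sup>2 - 2 * ((x - ?c) \<bullet> (y - ?c))" if "y \<in> S" for y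
  proof -
    have "dist ?c x = R" "dist ?c y = R" using that assms by auto
    then show ?thesis
      using two_inner_dist[of x ?c y] by (simp add: dist_commute)
  qed
  have "(\<Sum>y\<in>S. bary S y *\<^sub>R (y - ?c)) = 0"
    using bary[OF assms(1)] by (simp add: scaleR_right_diff_distrib sum_subtractf flip: scaleR_left.sum)
  then have "(x - ?c) \<bullet> (\<Sum>y\<in>S. bary S y *\<^sub>R (y - ?c)) = 0"
    by simp
  then have i: "(\<Sum>y\<in>S. bary S y * ((x - ?c) \<bullet> (y - ?c))) = 0"
    by (simp only: inner_sum_right inner_scaleR_right)
  have "(\<Sum>y\<in>S. bary S y * (dist x y)\<^sup>2)
      = (\<Sum>y\<in>S. 2 * R\<^sup>2 * bary S y - 2 * (bary S y * ((x - ?c) \<bullet> (y - ?c))))"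
    by (intro sum.cong refl) (simp only: *, simp only: right_diff_distrib mult.left_commute mult.commute)
  also have "\<dots> = 2 * R\<^sup>2 * sum (bary S) S - 2 * (\<Sum>y\<in>S. bary S y * ((x - ?c) \<bullet> (y - ?c)))"
    by (simp add: sum_subtractf sum_distrib_left)
  finally show ?thesis using i bary(1)[OF assms(1)] by simp
qed

text \<open>The weighted vectors from the circumcenter to the vertices sum to zero, and each has
  length R times its absolute weight: the claim is the triangle inequality.\<close>

lemma bary_abs_le:
  assumes "generic S" "x \<in> S"
  shows "\<bar>bary S x\<bar> \<le> (\<Sum>y\<in>S - {x}. \<bar>bary S y\<bar>)"
proof -
  obtain R where R: "S \<subseteq> sphere (circumcenter S) R" "R > 0"
    using generic_circumsphere[OF assms(1)] .
  let ?c = "circumcenter S"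
  have n: "norm (y - ?c) = R" if "y \<in> S" for y
    using R(1) that by (auto simp: dist_norm norm_minus_commute)
  have "(\<Sum>y\<in>S. bary S y *\<^sub>R (y - ?c)) = 0"
    using bary[OF assms(1)] by (simp add: scaleR_right_diff_distrib sum_subtractf flip: scaleR_left.sum)
  then have "bary S x *\<^sub>R (x - ?c) = - (\<Sum>y\<in>S - {x}. bary S y *\<^sub>R (y - ?c))"
    using sum.remove[OF generic_finite[OF assms(1)] assms(2), of "\<lambda>y. bary S y *\<^sub>R (y - ?c)"]
    by (simp add: eq_neg_iff_add_eq_0)
  then have "norm (bary S x *\<^sub>R (x - ?c)) \<le> (\<Sum>y\<in>S - {x}. norm (bary S y *\<^sub>R (y - ?c)))"
    by (simp add: norm_sum del: norm_scaleR)
  also have "\<dots> = (\<Sum>y\<in>S - {x}. \<bar>bary S y\<bar>) * R"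
    unfolding sum_distrib_right using n by (intro sum.cong) auto
  finally show ?thesis using n[OF assms(2)] R(2) by simp
qed

section \<open>Labelled quadruples and the criteria for activity\<close>

locale tetrahedron =
  fixes S :: "point set" and p q r s :: point
  assumes generic: "generic S" and S_eq: "S = {p, q, r, s}"
begin

lemma distinct: "p \<noteq> q" "p \<noteq> r" "p \<noteq> s" "q \<noteq> r" "q \<noteq> s" "r \<noteq> s"
  using generic card_four[of p q r s] by (auto simp: generic_def S_eq)

lemma bary_nonzero: "bary S p \<noteq> 0" "bary S q \<noteq> 0" "bary S r \<noteq> 0" "bary S s \<noteq> 0"
  using bary_nonzero[OF generic] S_eq by auto

lemma bary_sum: "bary S p + bary S q + bary S r + bary S s = 1"
  using bary(1)[OF generic] distinct by (simp add: S_eq add.assoc)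

lemma bary_row:
  assumes "S \<subseteq> sphere (circumcenter S) R"
  shows "bary S q * (dist p q)\<^sup>2 + bary S r * (dist p r)\<^sup>2 + bary S s * (dist p s)\<^sup>2 = 2 * R\<^sup>2"
  using bary_row[OF generic assms, of p] distinct by (simp add: S_eq add.assoc)

text \<open>With u, v the vectors from the circumcenter to p and q, |u - v|^2 = 4 R^2 - |u + v|^2.
  If u + v were zero, the circumcenter would be the midpoint of pq and its coordinate at r would
  vanish.\<close>

lemma dist_less_diameter:
  assumes "S \<subseteq> sphere (circumcenter S) R"
  shows "(dist p q)\<^sup>2 < 4 * R\<^sup>2"
proof -
  let ?c = "circumcenter S"
  have "norm (p - ?c) = R" "norm (q - ?c) = R"
    using assms by (auto simp: dist_norm norm_minus_commute S_eq)
  then have n: "(p - ?c) \<bullet> (p - ?c) = R\<^sup>2" "(q - ?c) \<bullet> (q - ?c) = R\<^sup>2"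
    by (auto simp: dot_square_norm)
  have "midpoint p q \<noteq> ?c"
  proof
    assume "midpoint p q = ?c"
    then have "bary S r = (if r = p \<or> r = q then 1 / 2 else 0)"
      using distinct
      by (intro bary_unique[OF generic]) (auto simp: S_eq midpoint_def scaleR_add_right)
    then show False using bary_nonzero distinct by auto
  qed
  moreover have "midpoint p q - ?c = ((p - ?c) + (q - ?c)) /\<^sub>R 2"
    by (simp add: midpoint_def algebra_simps flip: scaleR_2)
  ultimately have "(p - ?c) + (q - ?c) \<noteq> 0" by auto
  then have "0 < ((p - ?c) + (q - ?c)) \<bullet> ((p - ?c) + (q - ?c))" by simp
  moreover have "(dist p q)\<^sup>2 = ((p - ?c) - (q - ?c)) \<bullet> ((p - ?c) - (q - ?c))"
    by (simp add: dist_norm power2_norm_eq_inner)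
  ultimately show ?thesis
    using n unfolding inner_add_left inner_add_right inner_diff_left[of "p - ?c"] inner_diff_right[of _ "p - ?c"]
    by (simp add: inner_commute)
qed

lemma face_facts: "\<not> affine_dependent {p, q, r}" "card {p, q, r} = 3" "{p, q, r} \<subseteq> S"
  using affine_dependent_subset[of "{p, q, r}" S] generic_indep[OF generic] distinct S_eq by auto

text \<open>A right angle at r makes the weight of r in \<open>circumcenter_triangle\<close> zero
  and those of p and q nonnegative, so the circumcenter of the face would lie on the edge
  pq.\<close>

lemma no_right_angle: "(p - r) \<bullet> (q - r) \<noteq> 0"
proof
  assume 0: "(p - r) \<bullet> (q - r) = 0"
  obtain w where w: "w > 0"
    "circumcenter {p, q, r} = ((dist q r)\<^sup>2 * ((q - p) \<bullet> (r - p)) * w) *\<^sub>R p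
      + ((dist p r)\<^sup>2 * ((p - q) \<bullet> (r - q)) * w) *\<^sub>R q
      + ((dist p q)\<^sup>2 * ((p - r) \<bullet> (q - r)) * w) *\<^sub>R r"
    "(dist q r)\<^sup>2 * ((q - p) \<bullet> (r - p)) * w + (dist p r)\<^sup>2 * ((p - q) \<bullet> (r - q)) * w
      + (dist p q)\<^sup>2 * ((p - r) \<bullet> (q - r)) * w = 1"
    using circumcenter_triangle[OF face_facts(1,2)] by metis
  define a b where "a = (dist q r)\<^sup>2 * ((q - p) \<bullet> (r - p)) * w" and "b = (dist p r)\<^sup>2 * ((p - q) \<bullet> (r - q)) * w"
  have c: "circumcenter {p, q, r} = a *\<^sub>R p + b *\<^sub>R q" "a + b = 1"
    using w 0 by (simp_all add: a_def b_def)
  have "(q - p) \<bullet> (r - p) \<ge> 0" "(p - q) \<bullet> (r - q) \<ge> 0"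
    using 0 two_inner_dist[of p r q] two_inner_dist[of q p r] two_inner_dist[of p q r]
      zero_le_power2[of "dist p r"] zero_le_power2[of "dist q r"]
    unfolding dist_commute[of q p] dist_commute[of r p] dist_commute[of r q] by linarith+
  then have "a \<ge> 0" "b \<ge> 0" using w(1) by (auto simp: a_def b_def)
  then have "circumcenter {p, q, r} \<in> closed_segment p q"
  proof -
    have "a = 1 - b" using c(2) by simp
    then have "circumcenter {p, q, r} = (1 - b) *\<^sub>R p + b *\<^sub>R q" "0 \<le> b" "b \<le> 1"
      using c(1) \<open>a \<ge> 0\<close> \<open>b \<ge> 0\<close> by simp_all
    then show ?thesis unfolding closed_segment_def by blast
  qed
  then show False
    using generic face_facts distinct unfolding generic_def by blast
qed

lemma not_obtuse_iff: "\<not> obtuse r p q \<longleftrightarrow> (p - r) \<bullet> (q - r) > 0"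
  using no_right_angle by (auto simp: obtuse_def)

text \<open>The midpoint is the only candidate, and p and q are exactly half the edge length away
  from it. For r and s, \<open>dist_midpoint_inner\<close> turns the comparison of distances into
  the sign of an inner product.\<close>

lemma active_edge: "active S {p, q} \<longleftrightarrow> \<not> obtuse r p q \<and> \<not> obtuse s p q"
proof -
  have "active S {p, q} \<longleftrightarrow> voronoi_face S {p, q} \<inter> closed_segment p q = {midpoint p q}"
  proof -
    have "{p, q} \<subseteq> S" "card {p, q} = 2" "p \<noteq> q" using S_eq distinct by auto
    moreover have "{p, q} \<noteq> {x}" for x using distinct by auto
    ultimately have "active S {p, q} \<longleftrightarrow> (\<exists>x y. x \<noteq> y \<and> {p, q} = {x, y}
        \<and> voronoi_face S {p, q} \<inter> closed_segment x y = {midpoint x y})"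
      unfolding active_def by simp
    then show ?thesis
      using \<open>p \<noteq> q\<close> by (metis doubleton_eq_iff closed_segment_commute midpoint_sym)
  qed
  also have "\<dots> \<longleftrightarrow> midpoint p q \<in> closed_segment p q \<and> (\<forall>x\<in>S. dist p q / 2 \<le> dist (midpoint p q) x)"
  proof (rule voronoi_face_inter)
    show "closed_segment p q \<subseteq> affine hull {p, q}"
      by (simp add: segment_convex_hull convex_hull_subset_affine_hull)
    then show "midpoint p q \<in> affine hull {p, q}"
      using midpoint_in_closed_segment by blast
  qed (auto simp: S_eq dist_midpoint)
  also have "\<dots> \<longleftrightarrow> (\<forall>x\<in>S. (dist p q / 2)\<^sup>2 \<le> (dist (midpoint p q) x)\<^sup>2)"
    by (simp add: midpoint_in_closed_segment power2_le_iff_abs_le)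
  also have "\<dots> \<longleftrightarrow> \<not> obtuse r p q \<and> \<not> obtuse s p q"
    unfolding dist_midpoint_inner by (auto simp: S_eq obtuse_def not_less)
  finally show ?thesis .
qed

text \<open>Lying in the closed ball means an inner product at most zero; since right angles do not
  occur, lying outside is the same as not being obtuse.\<close>

lemma gabriel_edge:
  "cball (midpoint p q) (dist p q / 2) \<inter> S = {p, q} \<longleftrightarrow> \<not> obtuse r p q \<and> \<not> obtuse s p q"
proof -
  interpret t: tetrahedron S p q s r
    by unfold_locales (use generic S_eq in auto)
  have in_cball: "x \<in> cball (midpoint p q) (dist p q / 2) \<longleftrightarrow> (p - x) \<bullet> (q - x) \<le> 0" for x
  proof -
    have "x \<in> cball (midpoint p q) (dist p q / 2) \<longleftrightarrow> (dist (midpoint p q) x)\<^sup>2 \<le> (dist p q / 2)\<^sup>2"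
      by (simp add: power2_le_iff_abs_le)
    then show ?thesis unfolding dist_midpoint_inner by simp
  qed
  have "cball (midpoint p q) (dist p q / 2) \<inter> S = {p, q}
      \<longleftrightarrow> r \<notin> cball (midpoint p q) (dist p q / 2) \<and> s \<notin> cball (midpoint p q) (dist p q / 2)"
    using distinct by (auto simp: S_eq in_cball simp del: mem_cball)
  then show ?thesis
    unfolding in_cball not_obtuse_iff t.not_obtuse_iff by auto
qed

text \<open>Let c be the circumcenter of the face and z that of the quadruple. Acuteness means that
  c lies in the triangle. The key identity is l(s) (|c - s|^2 - |c - p|^2) = 2 |c - z|^2 > 0: the
  sign of l(s) tells whether s is outside the sphere about c through p, q, r.\<close>

lemma active_face:
  "active S {p, q, r} \<longleftrightarrow> \<not> obtuse p q r \<and> \<not> obtuse q p r \<and> \<not> obtuse r p q \<and> bary S s > 0"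
proof -
  interpret q: tetrahedron S p r q s
    by unfold_locales (use generic S_eq in auto)
  interpret p: tetrahedron S q r p s
    by unfold_locales (use generic S_eq in auto)
  define c where "c = circumcenter {p, q, r}"
  obtain w where w: "w > 0"
    "c = ((dist q r)\<^sup>2 * ((q - p) \<bullet> (r - p)) * w) *\<^sub>R p
      + ((dist p r)\<^sup>2 * ((p - q) \<bullet> (r - q)) * w) *\<^sub>R q
      + ((dist p q)\<^sup>2 * ((p - r) \<bullet> (q - r)) * w) *\<^sub>R r"
    "(dist q r)\<^sup>2 * ((q - p) \<bullet> (r - p)) * w + (dist p r)\<^sup>2 * ((p - q) \<bullet> (r - q)) * w
      + (dist p q)\<^sup>2 * ((p - r) \<bullet> (q - r)) * w = 1"
    "dist c q = dist c p" "dist c r = dist c p"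
    unfolding c_def by (rule circumcenter_triangle[OF face_facts(1,2)])
  define a b d where "a = (dist q r)\<^sup>2 * ((q - p) \<bullet> (r - p)) * w"
    and "b = (dist p r)\<^sup>2 * ((p - q) \<bullet> (r - q)) * w"
    and "d = (dist p q)\<^sup>2 * ((p - r) \<bullet> (q - r)) * w"
  have c: "c = a *\<^sub>R p + b *\<^sub>R q + d *\<^sub>R r" "a + b + d = 1"
    using w(2,3) by (simp_all add: a_def b_def d_def)
  have "(q - p) \<bullet> (r - p) > 0 \<longleftrightarrow> a \<ge> 0" "(p - q) \<bullet> (r - q) > 0 \<longleftrightarrow> b \<ge> 0"
    "(p - r) \<bullet> (q - r) > 0 \<longleftrightarrow> d \<ge> 0"
    using w(1) distinct p.no_right_angle q.no_right_angle no_right_angle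
    by (auto simp: a_def b_def d_def zero_le_mult_iff less_le)
  then have abd: "\<not> obtuse p q r \<longleftrightarrow> a \<ge> 0" "\<not> obtuse q p r \<longleftrightarrow> b \<ge> 0" "\<not> obtuse r p q \<longleftrightarrow> d \<ge> 0"
    unfolding p.not_obtuse_iff q.not_obtuse_iff not_obtuse_iff by auto
  have aff: "c \<in> affine hull {p, q, r}"
    unfolding affine_hull_3 using c by blast
  have hull: "c \<in> convex hull {p, q, r} \<longleftrightarrow> a \<ge> 0 \<and> b \<ge> 0 \<and> d \<ge> 0"
  proof
    assume "c \<in> convex hull {p, q, r}"
    then obtain l where l: "\<forall>x\<in>{p, q, r}. 0 \<le> l x" "sum l {p, q, r} = 1" "(\<Sum>x\<in>{p, q, r}. l x *\<^sub>R x) = c"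
      unfolding convex_hull_finite[of "{p, q, r}", simplified] by auto
    define m where "m = (\<lambda>x. if x = p then a else if x = q then b else d)"
    have "sum m {p, q, r} = 1" "(\<Sum>x\<in>{p, q, r}. m x *\<^sub>R x) = c"
      using c distinct by (auto simp: m_def add.assoc)
    then have "l x = m x" if "x \<in> {p, q, r}" for x
      using affine_coordinates_unique[OF face_facts(1) _ _ _ that, of l m] l by simp
    then have "l p = a" "l q = b" "l r = d"
      using distinct by (auto simp: m_def)
    then show "a \<ge> 0 \<and> b \<ge> 0 \<and> d \<ge> 0" using l(1) by auto
  next
    assume "a \<ge> 0 \<and> b \<ge> 0 \<and> d \<ge> 0"
    then show "c \<in> convex hull {p, q, r}"
      unfolding convex_hull_3 using c by blast
  qed
  have "{p, q, r} \<noteq> {x, y}" for x y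
  proof
    assume "{p, q, r} = {x, y}"
    then have "card {x, y} = 3" using face_facts(2) by simp
    then show False using card_insert_le_m1[of 2 "{y}" x] by simp
  qed
  then have "active S {p, q, r} \<longleftrightarrow> voronoi_face S {p, q, r} \<inter> convex hull {p, q, r} = {c}"
    using face_facts(2,3) unfolding active_def c_def by (auto simp del: card_insert_disjoint)
  also have "\<dots> \<longleftrightarrow> c \<in> convex hull {p, q, r} \<and> (\<forall>x\<in>S. dist c p \<le> dist c x)"
    using face_facts(3) aff w(4,5)
    by (intro voronoi_face_inter) (auto simp: convex_hull_subset_affine_hull)
  also have "\<dots> \<longleftrightarrow> (a \<ge> 0 \<and> b \<ge> 0 \<and> d \<ge> 0) \<and> dist c p \<le> dist c s"
    unfolding hull using w(4,5) by (simp add: S_eq)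
  finally have act: "active S {p, q, r} \<longleftrightarrow> (a \<ge> 0 \<and> b \<ge> 0 \<and> d \<ge> 0) \<and> dist c p \<le> dist c s" .
  define z where "z = circumcenter S"
  obtain R where R: "S \<subseteq> sphere z R" "R > 0"
    using generic_circumsphere[OF generic] unfolding z_def .
  have "z \<noteq> c"
    using generic aff face_facts unfolding generic_def z_def by metis
  have sq: "(dist c x)\<^sup>2 = R\<^sup>2 + (dist c z)\<^sup>2 - 2 * ((x - z) \<bullet> (c - z))" if "x \<in> S" for x
  proof -
    have "dist z x = R" using R(1) that by auto
    then show ?thesis using two_inner_dist[of x z c] by (simp add: dist_commute)
  qed
  \<comment> \<open>c is the foot of the perpendicular from z: the vectors x - z, for x in the face,
    have the same product with c - z, and averaging with the weights of c identifies it as |c -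
    z|^2.\<close>
  have "a * ((p - z) \<bullet> (c - z)) + b * ((q - z) \<bullet> (c - z)) + d * ((r - z) \<bullet> (c - z))
      = (a *\<^sub>R (p - z) + b *\<^sub>R (q - z) + d *\<^sub>R (r - z)) \<bullet> (c - z)"
    by (simp add: inner_add_left)
  also have "a *\<^sub>R (p - z) + b *\<^sub>R (q - z) + d *\<^sub>R (r - z) = (a *\<^sub>R p + b *\<^sub>R q + d *\<^sub>R r) - (a + b + d) *\<^sub>R z"
    by (simp add: algebra_simps)
  also have "\<dots> \<bullet> (c - z) = (dist c z)\<^sup>2"
    using c by (simp add: dist_norm power2_norm_eq_inner)
  moreover have qrz: "(q - z) \<bullet> (c - z) = (p - z) \<bullet> (c - z)" "(r - z) \<bullet> (c - z) = (p - z) \<bullet> (c - z)"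
    using sq[of p] sq[of q] sq[of r] w(4,5) by (auto simp: S_eq)
  ultimately have pz: "(p - z) \<bullet> (c - z) = (dist c z)\<^sup>2"
    using c(2) by (metis distrib_right mult_1)
  \<comment> \<open>The barycentric relation of z is paired with c - z, which isolates the
    contribution of s.\<close>
  have "bary S p * ((p - z) \<bullet> (c - z)) + bary S q * ((q - z) \<bullet> (c - z))
      + bary S r * ((r - z) \<bullet> (c - z)) + bary S s * ((s - z) \<bullet> (c - z))
      = ((bary S p *\<^sub>R p + bary S q *\<^sub>R q + bary S r *\<^sub>R r + bary S s *\<^sub>R s)
         - (bary S p + bary S q + bary S r + bary S s) *\<^sub>R z) \<bullet> (c - z)"
    by (simp add: inner_add_left inner_diff_left algebra_simps)
  also have "bary S p *\<^sub>R p + bary S q *\<^sub>R q + bary S r *\<^sub>R r + bary S s *\<^sub>R s = z"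
    using bary(2)[OF generic] distinct by (simp add: S_eq z_def add.assoc)
  finally have "bary S p * ((p - z) \<bullet> (c - z)) + bary S q * ((q - z) \<bullet> (c - z))
      + bary S r * ((r - z) \<bullet> (c - z)) + bary S s * ((s - z) \<bullet> (c - z)) = 0"
    unfolding bary_sum by simp
  then have "(bary S p + bary S q + bary S r) * (dist c z)\<^sup>2 + bary S s * ((s - z) \<bullet> (c - z)) = 0"
    unfolding qrz pz distrib_right .
  moreover have "bary S p + bary S q + bary S r = 1 - bary S s" using bary_sum by simp
  ultimately have "(1 - bary S s) * (dist c z)\<^sup>2 + bary S s * ((s - z) \<bullet> (c - z)) = 0"
    by metis
  then have "bary S s * ((dist c z)\<^sup>2 - (s - z) \<bullet> (c - z)) = (dist c z)\<^sup>2"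
    unfolding left_diff_distrib[of 1] right_diff_distrib[of "bary S s"] by linarith
  moreover have "(dist c s)\<^sup>2 - (dist c p)\<^sup>2 = 2 * ((dist c z)\<^sup>2 - (s - z) \<bullet> (c - z))"
    using sq[of p] sq[of s] pz by (simp add: S_eq)
  ultimately have "bary S s * ((dist c s)\<^sup>2 - (dist c p)\<^sup>2) = 2 * (dist c z)\<^sup>2"
    by (metis mult.left_commute)
  also have "2 * (dist c z)\<^sup>2 > 0" using \<open>z \<noteq> c\<close> by simp
  \<comment> \<open>The product is nonzero, so equal distances are impossible and
    \<open>\<le>\<close> can replace \<open><\<close>.\<close>
  finally have "bary S s > 0 \<longleftrightarrow> (dist c p)\<^sup>2 \<le> (dist c s)\<^sup>2"
    unfolding zero_less_mult_iff by linarith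
  also have "\<dots> \<longleftrightarrow> dist c p \<le> dist c s" by simp
  finally show ?thesis
    unfolding act abd by blast
qed

lemma active_solid: "active S {p, q, r, s} \<longleftrightarrow> bary S p > 0 \<and> bary S q > 0 \<and> bary S r > 0 \<and> bary S s > 0"
proof -
  have "card {p, q, r, s} = 4" using distinct by simp
  moreover have "{p, q, r, s} \<noteq> {x, y}" for x y
  proof
    assume "{p, q, r, s} = {x, y}"
    then have "card {x, y} = 4" using \<open>card {p, q, r, s} = 4\<close> by simp
    then show False using card_insert_le_m1[of 2 "{y}" x] by simp
  qed
  ultimately have "active S {p, q, r, s} \<longleftrightarrow> circumcenter S \<in> convex hull S"
    unfolding active_def S_eq by auto
  then show ?thesis unfolding circumcenter_in_hull_iff[OF generic] by (auto simp: S_eq)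
qed

section \<open>Sign relations\<close>

text \<open>Facts are proved for one labelling of the vertices; this transports them to the
  others.\<close>

lemma any_perm: "{p', q', r', s'} = {p, q, r, s} \<Longrightarrow> tetrahedron S p' q' r' s'"
  using generic S_eq by unfold_locales auto

text \<open>Add the rows of p and q and subtract \<open>(dist p q)\<^sup>2\<close> times the sum of
  the coordinates. What remains is l(r) and l(s), each multiplied by a number that is negative
  exactly at an obtuse angle, with the positive sum 4 R^2 - \<open>(dist p q)\<^sup>2\<close>. So
  one of the two products is positive.\<close>

lemma obtuse_opposite_edge:
  "(bary S r > 0) \<noteq> obtuse r p q \<or> (bary S s > 0) \<noteq> obtuse s p q"
proof -
  obtain R where R: "S \<subseteq> sphere (circumcenter S) R" "R > 0"
    using generic_circumsphere[OF generic] .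
  interpret q: tetrahedron S q p r s by (rule any_perm) auto
  let ?r = "(dist p r)\<^sup>2 + (dist q r)\<^sup>2 - (dist p q)\<^sup>2" and ?s = "(dist p s)\<^sup>2 + (dist q s)\<^sup>2 - (dist p q)\<^sup>2"
  have "bary S r * ?r + bary S s * ?s
    = (bary S q * (dist p q)\<^sup>2 + bary S r * (dist p r)\<^sup>2 + bary S s * (dist p s)\<^sup>2)
      + (bary S p * (dist q p)\<^sup>2 + bary S r * (dist q r)\<^sup>2 + bary S s * (dist q s)\<^sup>2)
      - (bary S p + bary S q + bary S r + bary S s) * (dist p q)\<^sup>2"
    unfolding dist_commute[of q p] by (simp only: algebra_simps)
  also have "\<dots> = 4 * R\<^sup>2 - (dist p q)\<^sup>2"
    unfolding bary_row[OF R(1)] q.bary_row[OF R(1)] bary_sum by simp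
  also have "\<dots> > 0" using dist_less_diameter[OF R(1)] by simp
  finally have "bary S r * ?r > 0 \<or> bary S s * ?s > 0" by linarith
  then show ?thesis
    unfolding obtuse_dist zero_less_mult_iff by linarith
qed

text \<open>If \<open>obtuse r p x\<close> or \<open>obtuse x p r\<close>, then \<open>x\<close> lies on the positive side of the linear functional
  below, which vanishes at \<open>p\<close> and at the circumcenter and is positive at \<open>r\<close>.\<close>

lemma not_both_obtuse:
  assumes pos: "bary S q > 0" "bary S r > 0" "bary S s > 0"
    and q: "obtuse r p q \<or> obtuse q p r" and s: "obtuse r p s \<or> obtuse s p r"
  shows False
proof -
  obtain R where R: "S \<subseteq> sphere (circumcenter S) R" "R > 0"
    using generic_circumsphere[OF generic] .
  interpret r: tetrahedron S r p q s by (rule any_perm) auto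
  interpret pr: tetrahedron S p r q s by (rule any_perm) auto
  interpret ps: tetrahedron S p s q r by (rule any_perm) auto
  define T where "T = 2 * R\<^sup>2"
  \<comment> \<open>On the circumsphere, with centre c, |x - p|^2 = 2 (x - p) . (c - p). Hence
    \<open>g x\<close> is 4 R^2 times the inner product of x - p with the part of r - p orthogonal
    to c - p.\<close>
  define g where "g = (\<lambda>x. T * ((dist p x)\<^sup>2 + (dist p r)\<^sup>2 - (dist r x)\<^sup>2) - (dist p r)\<^sup>2 * (dist p x)\<^sup>2)"
  have diam: "2 * T - (dist p q)\<^sup>2 > 0" "2 * T - (dist p r)\<^sup>2 > 0" "2 * T - (dist p s)\<^sup>2 > 0"
    using dist_less_diameter[OF R(1)] pr.dist_less_diameter[OF R(1)] ps.dist_less_diameter[OF R(1)]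
    by (simp_all add: T_def)
  have T: "T > 0" using R(2) by (simp add: T_def)
  have gx: "g x > 0" if x: "obtuse r p x \<or> obtuse x p r" "2 * T - (dist p x)\<^sup>2 > 0" "x \<noteq> p" for x
    using x(1)
  proof
    assume "obtuse r p x"
    then have "(dist r x)\<^sup>2 < (dist p x)\<^sup>2 - (dist p r)\<^sup>2"
      unfolding obtuse_dist dist_commute[of x r] by linarith
    then have "T * (2 * (dist p r)\<^sup>2) < T * ((dist p x)\<^sup>2 + (dist p r)\<^sup>2 - (dist r x)\<^sup>2)"
      using T by (intro mult_strict_left_mono) auto
    moreover have "0 < (dist p r)\<^sup>2 * (2 * T - (dist p x)\<^sup>2)"
      using x distinct by simp
    ultimately show ?thesis unfolding g_def by (simp add: algebra_simps)
  next
    assume "obtuse x p r"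
    then have "(dist r x)\<^sup>2 < (dist p r)\<^sup>2 - (dist p x)\<^sup>2"
      unfolding obtuse_dist by linarith
    then have "T * (2 * (dist p x)\<^sup>2) < T * ((dist p x)\<^sup>2 + (dist p r)\<^sup>2 - (dist r x)\<^sup>2)"
      using T by (intro mult_strict_left_mono) auto
    moreover have "0 < (dist p x)\<^sup>2 * (2 * T - (dist p r)\<^sup>2)"
      using x diam by simp
    ultimately show ?thesis unfolding g_def by (simp add: algebra_simps)
  qed
  have "g r = (dist p r)\<^sup>2 * (2 * T - (dist p r)\<^sup>2)"
    by (simp add: g_def algebra_simps)
  then have gr: "g r > 0" using diam distinct by simp
  have gp: "g p = 0" by (simp add: g_def dist_commute)
  \<comment> \<open>The barycentric average is the value of the functional at the circumcenter,
    hence zero, while the terms of q, r and s are positive.\<close>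
  have "bary S p * g p + bary S q * g q + bary S r * g r + bary S s * g s
    = (T - (dist p r)\<^sup>2) * (bary S q * (dist p q)\<^sup>2 + bary S r * (dist p r)\<^sup>2 + bary S s * (dist p s)\<^sup>2)
      + T * (bary S p + bary S q + bary S r + bary S s) * (dist p r)\<^sup>2
      - T * (bary S p * (dist r p)\<^sup>2 + bary S q * (dist r q)\<^sup>2 + bary S s * (dist r s)\<^sup>2)"
    unfolding g_def dist_self by (simp add: algebra_simps)
  also have "\<dots> = 0"
    unfolding bary_row[OF R(1)] r.bary_row[OF R(1)] bary_sum T_def by (simp add: algebra_simps)
  finally have "bary S q * g q + bary S r * g r + bary S s * g s = 0"
    unfolding gp by simp
  moreover have "bary S q * g q > 0" "bary S r * g r > 0" "bary S s * g s > 0"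
    using gx[OF q diam(1)] gr gx[OF s diam(3)] pos distinct by auto
  ultimately show False by linarith
qed

text \<open>The rows of p and r have the same value. If the angle at p over rs were not obtuse,
  their difference would give l(q) + l(r) - l(p) < l(s). As l(p) is not positive, this contradicts
  \<open>bary_abs_le\<close> at s.\<close>

lemma obtuse_neighbour:
  assumes pos: "bary S q > 0" "bary S r > 0" "bary S s > 0" and neg: "\<not> bary S p > 0"
    and obt: "obtuse r p q"
  shows "obtuse p r s"
proof (rule ccontr)
  assume "\<not> obtuse p r s"
  then have rs: "(dist r s)\<^sup>2 \<le> (dist p s)\<^sup>2 + (dist p r)\<^sup>2"
    by (simp add: obtuse_dist dist_commute)
  obtain R where R: "S \<subseteq> sphere (circumcenter S) R" "R > 0"
    using generic_circumsphere[OF generic] .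
  interpret r: tetrahedron S r p q s by (rule any_perm) auto
  have "bary S s * ((dist r s)\<^sup>2 - (dist p s)\<^sup>2) \<le> bary S s * (dist p r)\<^sup>2"
    using rs pos by (intro mult_left_mono) auto
  moreover have "bary S q * (dist p r)\<^sup>2 < bary S q * ((dist p q)\<^sup>2 - (dist r q)\<^sup>2)"
    using obt pos by (intro mult_strict_left_mono) (simp_all add: obtuse_dist dist_commute)
  moreover have "bary S q * (dist p q)\<^sup>2 + bary S r * (dist p r)\<^sup>2 + bary S s * (dist p s)\<^sup>2
      = bary S p * (dist p r)\<^sup>2 + bary S q * (dist r q)\<^sup>2 + bary S s * (dist r s)\<^sup>2"
    using bary_row[OF R(1)] r.bary_row[OF R(1)] by (simp add: dist_commute)
  ultimately have "(bary S q + bary S r - bary S p) * (dist p r)\<^sup>2 < bary S s * (dist p r)\<^sup>2"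
    by (simp add: algebra_simps)
  then have "bary S q + bary S r - bary S p < bary S s"
    by (simp add: mult_less_cancel_right)
  moreover have "S - {s} = {p, q, r}" using S_eq distinct by auto
  then have "\<bar>bary S s\<bar> \<le> \<bar>bary S p\<bar> + \<bar>bary S q\<bar> + \<bar>bary S r\<bar>"
    using bary_abs_le[OF generic, of s] distinct S_eq by (simp add: add.assoc)
  ultimately show False using pos neg by linarith
qed

text \<open>Oriented so that the last two arguments follow the order p, q, r, s; each of the twelve
  angles then has a single name.\<close>

lemmas obtuse_sym = obtuse_commute[of p r q] obtuse_commute[of p s q] obtuse_commute[of p s r]
  obtuse_commute[of q r p] obtuse_commute[of q s p] obtuse_commute[of q s r]
  obtuse_commute[of r q p] obtuse_commute[of r s p] obtuse_commute[of r s q]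
  obtuse_commute[of s q p] obtuse_commute[of s r p] obtuse_commute[of s r q]

section \<open>The relations in all labellings, and connectedness of the Gabriel graph\<close>

lemma active_edges:
  "active S {p, q} \<longleftrightarrow> \<not> obtuse r p q \<and> \<not> obtuse s p q"
  "active S {p, r} \<longleftrightarrow> \<not> obtuse q p r \<and> \<not> obtuse s p r"
  "active S {p, s} \<longleftrightarrow> \<not> obtuse q p s \<and> \<not> obtuse r p s"
  "active S {q, r} \<longleftrightarrow> \<not> obtuse p q r \<and> \<not> obtuse s q r"
  "active S {q, s} \<longleftrightarrow> \<not> obtuse p q s \<and> \<not> obtuse r q s"
  "active S {r, s} \<longleftrightarrow> \<not> obtuse p r s \<and> \<not> obtuse q r s"
  by (rule tetrahedron.active_edge[OF any_perm]; auto)+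

lemma active_faces:
  "active S {p, q, r} \<longleftrightarrow> \<not> obtuse p q r \<and> \<not> obtuse q p r \<and> \<not> obtuse r p q \<and> bary S s > 0"
  "active S {p, q, s} \<longleftrightarrow> \<not> obtuse p q s \<and> \<not> obtuse q p s \<and> \<not> obtuse s p q \<and> bary S r > 0"
  "active S {p, r, s} \<longleftrightarrow> \<not> obtuse p r s \<and> \<not> obtuse r p s \<and> \<not> obtuse s p r \<and> bary S q > 0"
  "active S {q, r, s} \<longleftrightarrow> \<not> obtuse q r s \<and> \<not> obtuse r q s \<and> \<not> obtuse s q r \<and> bary S p > 0"
  by (rule tetrahedron.active_face[OF any_perm]; auto)+

lemmas activity = active_edges active_faces active_solid

lemma obtuse_opposite_edges:
  "(bary S r > 0) \<noteq> obtuse r p q \<or> (bary S s > 0) \<noteq> obtuse s p q"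
  "(bary S q > 0) \<noteq> obtuse q p r \<or> (bary S s > 0) \<noteq> obtuse s p r"
  "(bary S q > 0) \<noteq> obtuse q p s \<or> (bary S r > 0) \<noteq> obtuse r p s"
  "(bary S p > 0) \<noteq> obtuse p q r \<or> (bary S s > 0) \<noteq> obtuse s q r"
  "(bary S p > 0) \<noteq> obtuse p q s \<or> (bary S r > 0) \<noteq> obtuse r q s"
  "(bary S p > 0) \<noteq> obtuse p r s \<or> (bary S q > 0) \<noteq> obtuse q r s"
  by (rule tetrahedron.obtuse_opposite_edge[OF any_perm]; auto)+

lemma obtuse_unique:
  "obtuse p q r \<Longrightarrow> \<not> obtuse q p r" "obtuse p q r \<Longrightarrow> \<not> obtuse r p q" "obtuse q p r \<Longrightarrow> \<not> obtuse r p q"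
  "obtuse p q s \<Longrightarrow> \<not> obtuse q p s" "obtuse p q s \<Longrightarrow> \<not> obtuse s p q" "obtuse q p s \<Longrightarrow> \<not> obtuse s p q"
  "obtuse p r s \<Longrightarrow> \<not> obtuse r p s" "obtuse p r s \<Longrightarrow> \<not> obtuse s p r" "obtuse r p s \<Longrightarrow> \<not> obtuse s p r"
  "obtuse q r s \<Longrightarrow> \<not> obtuse r q s" "obtuse q r s \<Longrightarrow> \<not> obtuse s q r" "obtuse r q s \<Longrightarrow> \<not> obtuse s q r"
  using not_obtuse_twice obtuse_commute by metis+

text \<open>The shortest edge across any cut of the vertices is active.\<close>

lemma active_edge_at: "active S {p, q} \<or> active S {p, r} \<or> active S {p, s}"
proof -
  \<comment> \<open>If an edge across the cut is opposite to an obtuse angle, the other two sides of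
    that triangle are shorter, and one of them crosses the cut too.\<close>
  have "(dist q r)\<^sup>2 > 0" "(dist q s)\<^sup>2 > 0" "(dist r s)\<^sup>2 > 0" using distinct by auto
  then show ?thesis
    unfolding active_edges obtuse_dist dist_commute[of r q] dist_commute[of s q] dist_commute[of s r]
    by linarith
qed

lemma active_edge_across: "active S {p, r} \<or> active S {p, s} \<or> active S {q, r} \<or> active S {q, s}"
proof -
  have "(dist p q)\<^sup>2 > 0" "(dist r s)\<^sup>2 > 0" using distinct by auto
  then show ?thesis
    unfolding active_edges obtuse_dist dist_commute[of r q] dist_commute[of s q] dist_commute[of s r]
      dist_commute[of q p] dist_commute[of r p] dist_commute[of s p]
    by linarith
qed

end

section \<open>Standard posets\<close>

text \<open>The two-point sets of the posets with a letter are exactly its \<open>letter_edges\<close>.\<close>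

definition models :: "(tetrahedron_type \<times> nat set set) set" where
  "models =
     {(((4, 6, 4, 1), None),
        {{1}, {2}, {3}, {4}, {1, 2}, {1, 3}, {1, 4}, {2, 3}, {2, 4}, {3, 4},
         {1, 2, 3}, {1, 2, 4}, {1, 3, 4}, {2, 3, 4}, {1, 2, 3, 4}}),
      (((4, 6, 3, 0), None),
        {{1}, {2}, {3}, {4}, {1, 2}, {1, 3}, {1, 4}, {2, 3}, {2, 4}, {3, 4},
         {1, 2, 3}, {1, 2, 4}, {1, 3, 4}}),
      (((4, 5, 3, 1), None),
        {{1}, {2}, {3}, {4}, {1, 3}, {1, 4}, {2, 3}, {2, 4}, {3, 4},
         {1, 2, 4}, {1, 3, 4}, {2, 3, 4}, {1, 2, 3, 4}}),
      (((4, 5, 2, 0), None),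
        {{1}, {2}, {3}, {4}, {1, 3}, {1, 4}, {2, 3}, {2, 4}, {3, 4}, {1, 3, 4}, {2, 3, 4}}),
      (((4, 4, 2, 1), Some Cycle_O),
        {{1}, {2}, {3}, {4}, {1, 2}, {2, 3}, {3, 4}, {1, 4}, {1, 3, 4}, {2, 3, 4}, {1, 2, 3, 4}}),
      (((4, 4, 1, 0), Some Cycle_O),
        {{1}, {2}, {3}, {4}, {1, 2}, {2, 3}, {3, 4}, {1, 4}, {2, 3, 4}}),
      (((4, 4, 1, 0), Some Paw_P),
        {{1}, {2}, {3}, {4}, {1, 2}, {2, 3}, {1, 3}, {3, 4}, {1, 2, 3}}),
      (((4, 3, 0, 0), Some Path_L), {{1}, {2}, {3}, {4}, {1, 2}, {2, 3}, {3, 4}}),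
      (((4, 3, 0, 0), Some Star_T), {{1}, {2}, {3}, {4}, {1, 2}, {1, 3}, {1, 4}})}"

text \<open>Equivalence of quadruples amounts to sharing a model, by
  \<open>combinatorially_equivalent_iff\<close>.\<close>

definition has_model :: "point set \<Rightarrow> nat set set \<Rightarrow> bool" where
  "has_model S M \<longleftrightarrow> (\<exists>f. bij_betw f {1..4} S \<and> (\<lambda>A. f ` A) ` M = morse_poset S)"

text \<open>This fixes the whole poset, not only its counts and its graph; on generic quadruples it
  nevertheless agrees with \<open>has_type\<close>, by \<open>has_type_iff_realizes\<close>.\<close>

definition realizes :: "point set \<Rightarrow> tetrahedron_type \<Rightarrow> bool" where
  "realizes S \<tau> \<longleftrightarrow> (\<exists>M. (\<tau>, M) \<in> models \<and> has_model S M)"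

lemma atLeast1AtMost4: "{1..4::nat} = {1, 2, 3, 4}"
  by auto

lemma Collect_mem_insert:
  "{x \<in> insert a A. P x} = (if P a then insert a {x \<in> A. P x} else {x \<in> A. P x})"
  by auto

context tetrahedron
begin

text \<open>Singletons are always active and the empty set never is. The other eleven subsets appear
  as a filtered explicit list, so that deciding their activity evaluates the poset.\<close>

lemma morse_poset_eq:
  "morse_poset S = {{p}, {q}, {r}, {s}} \<union>
     {A \<in> {{p, q}, {p, r}, {p, s}, {q, r}, {q, s}, {r, s},
       {p, q, r}, {p, q, s}, {p, r, s}, {q, r, s}, {p, q, r, s}}. active S A}"
proof -
  have "morse_poset S = {A \<in> Pow {p, q, r, s} - {{}}. active S A}"
    by (auto simp: morse_poset_def active_def S_eq)
  also have "Pow {p, q, r, s} - {{}} = {{p}, {q}, {r}, {s}} \<union> {{p, q}, {p, r}, {p, s}, {q, r}, {q, s}, {r, s},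
       {p, q, r}, {p, q, s}, {p, r, s}, {q, r, s}, {p, q, r, s}}"
    by (simp add: Pow_insert insert_commute insert_Diff_if)
  also have "{A \<in> {{p}, {q}, {r}, {s}} \<union> B. active S A} = {{p}, {q}, {r}, {s}} \<union> {A \<in> B. active S A}" for B
  proof -
    have "active S {x}" if "x \<in> S" for x using that by (auto simp: active_def)
    then show ?thesis by (auto simp: S_eq)
  qed
  finally show ?thesis .
qed

lemma has_modelI:
  assumes "(\<lambda>A. (\<lambda>i. if i = 1 then p else if i = 2 then q else if i = 3 then r else s) ` A) ` M = morse_poset S"
  shows "has_model S M"
  unfolding has_model_def
proof (intro exI conjI)
  show "bij_betw (\<lambda>i::nat. if i = 1 then p else if i = 2 then q else if i = 3 then r else s) {1..4} S"
    unfolding atLeast1AtMost4 using distinct by (auto simp: bij_betw_def inj_on_def S_eq)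
qed (fact assms)

text \<open>Here and in the eight companion lemmas p, q, r, s receive the numbers 1, 2, 3, 4, and
  the hypotheses decide all eleven subsets with at least two points.\<close>

lemma realizes_4_6_4_1:
  assumes "active S {p, q}" "active S {p, r}" "active S {p, s}" "active S {q, r}" "active S {q, s}"
    "active S {r, s}" "active S {p, q, r}" "active S {p, q, s}" "active S {p, r, s}" "active S {q, r, s}"
    "active S {p, q, r, s}"
  shows "realizes S ((4, 6, 4, 1), None)"
  unfolding realizes_def models_def
  by (rule exI, rule conjI, (rule insertI1 | rule insertI2)+, rule has_modelI) (simp only: morse_poset_eq Collect_mem_insert assms if_True if_False simp_thms, simp add: insert_commute)

lemma realizes_4_6_3_0:
  assumes "active S {p, q}" "active S {p, r}" "active S {p, s}" "active S {q, r}" "active S {q, s}"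
    "active S {r, s}" "active S {p, q, r}" "active S {p, q, s}" "active S {p, r, s}"
    "\<not> active S {q, r, s}" "\<not> active S {p, q, r, s}"
  shows "realizes S ((4, 6, 3, 0), None)"
  unfolding realizes_def models_def
  by (rule exI, rule conjI, (rule insertI1 | rule insertI2)+, rule has_modelI) (simp only: morse_poset_eq Collect_mem_insert assms if_True if_False simp_thms, simp add: insert_commute)

lemma realizes_4_5_3_1:
  assumes "active S {p, r}" "active S {p, s}" "active S {q, r}" "active S {q, s}" "active S {r, s}"
    "active S {p, q, s}" "active S {p, r, s}" "active S {q, r, s}" "active S {p, q, r, s}"
    "\<not> active S {p, q}" "\<not> active S {p, q, r}"
  shows "realizes S ((4, 5, 3, 1), None)"
  unfolding realizes_def models_def
  by (rule exI, rule conjI, (rule insertI1 | rule insertI2)+, rule has_modelI) (simp only: morse_poset_eq Collect_mem_insert assms if_True if_False simp_thms, simp add: insert_commute)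

lemma realizes_4_5_2_0:
  assumes "active S {p, r}" "active S {p, s}" "active S {q, r}" "active S {q, s}" "active S {r, s}"
    "active S {p, r, s}" "active S {q, r, s}" "\<not> active S {p, q}" "\<not> active S {p, q, r}"
    "\<not> active S {p, q, s}" "\<not> active S {p, q, r, s}"
  shows "realizes S ((4, 5, 2, 0), None)"
  unfolding realizes_def models_def
  by (rule exI, rule conjI, (rule insertI1 | rule insertI2)+, rule has_modelI) (simp only: morse_poset_eq Collect_mem_insert assms if_True if_False simp_thms, simp add: insert_commute)

lemma realizes_4_4_2_1_O:
  assumes "active S {p, q}" "active S {p, s}" "active S {q, r}" "active S {r, s}" "active S {p, r, s}"
    "active S {q, r, s}" "active S {p, q, r, s}" "\<not> active S {p, r}" "\<not> active S {q, s}"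
    "\<not> active S {p, q, r}" "\<not> active S {p, q, s}"
  shows "realizes S ((4, 4, 2, 1), Some Cycle_O)"
  unfolding realizes_def models_def
  by (rule exI, rule conjI, (rule insertI1 | rule insertI2)+, rule has_modelI) (simp only: morse_poset_eq Collect_mem_insert assms if_True if_False simp_thms, simp add: insert_commute)

lemma realizes_4_4_1_0_O:
  assumes "active S {p, q}" "active S {p, s}" "active S {q, r}" "active S {r, s}" "active S {q, r, s}"
    "\<not> active S {p, r}" "\<not> active S {q, s}" "\<not> active S {p, q, r}"
    "\<not> active S {p, q, s}" "\<not> active S {p, r, s}" "\<not> active S {p, q, r, s}"
  shows "realizes S ((4, 4, 1, 0), Some Cycle_O)"
  unfolding realizes_def models_def
  by (rule exI, rule conjI, (rule insertI1 | rule insertI2)+, rule has_modelI) (simp only: morse_poset_eq Collect_mem_insert assms if_True if_False simp_thms, simp add: insert_commute)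

lemma realizes_4_4_1_0_P:
  assumes "active S {p, q}" "active S {p, r}" "active S {q, r}" "active S {r, s}" "active S {p, q, r}"
    "\<not> active S {p, s}" "\<not> active S {q, s}" "\<not> active S {p, q, s}"
    "\<not> active S {p, r, s}" "\<not> active S {q, r, s}" "\<not> active S {p, q, r, s}"
  shows "realizes S ((4, 4, 1, 0), Some Paw_P)"
  unfolding realizes_def models_def
  by (rule exI, rule conjI, (rule insertI1 | rule insertI2)+, rule has_modelI) (simp only: morse_poset_eq Collect_mem_insert assms if_True if_False simp_thms, simp add: insert_commute)

lemma realizes_4_3_0_0_L:
  assumes "active S {p, q}" "active S {q, r}" "active S {r, s}" "\<not> active S {p, r}"
    "\<not> active S {p, s}" "\<not> active S {q, s}" "\<not> active S {p, q, r}"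
    "\<not> active S {p, q, s}" "\<not> active S {p, r, s}" "\<not> active S {q, r, s}"
    "\<not> active S {p, q, r, s}"
  shows "realizes S ((4, 3, 0, 0), Some Path_L)"
  unfolding realizes_def models_def
  by (rule exI, rule conjI, (rule insertI1 | rule insertI2)+, rule has_modelI) (simp only: morse_poset_eq Collect_mem_insert assms if_True if_False simp_thms, simp add: insert_commute)

lemma realizes_4_3_0_0_T:
  assumes "active S {p, q}" "active S {p, r}" "active S {p, s}" "\<not> active S {q, r}"
    "\<not> active S {q, s}" "\<not> active S {r, s}" "\<not> active S {p, q, r}"
    "\<not> active S {p, q, s}" "\<not> active S {p, r, s}" "\<not> active S {q, r, s}"
    "\<not> active S {p, q, r, s}"
  shows "realizes S ((4, 3, 0, 0), Some Star_T)"
  unfolding realizes_def models_def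
  by (rule exI, rule conjI, (rule insertI1 | rule insertI2)+, rule has_modelI) (simp only: morse_poset_eq Collect_mem_insert assms if_True if_False simp_thms, simp add: insert_commute)

section \<open>Classification by the Gabriel graph\<close>

text \<open>Without obtuse angles, the relation of an edge says that one of the two vertices off it
  has a positive coordinate. So at most one coordinate is negative, and it deactivates only the
  opposite face and the whole set.\<close>

lemma complete_case:
  assumes E: "active S {p, q}" "active S {p, r}" "active S {p, s}" "active S {q, r}" "active S {q, s}" "active S {r, s}"
  shows "\<exists>\<tau>. realizes S \<tau>"
proof -
  note acute = E[unfolded active_edges]
  have pos: "bary S r > 0 \<or> bary S s > 0" "bary S q > 0 \<or> bary S s > 0" "bary S q > 0 \<or> bary S r > 0"
    "bary S p > 0 \<or> bary S s > 0" "bary S p > 0 \<or> bary S r > 0" "bary S p > 0 \<or> bary S q > 0"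
    using obtuse_opposite_edges acute by blast+
  have one_neg: "realizes S' ((4, 6, 3, 0), None)"
    if t: "tetrahedron S' x y z w" and "\<not> bary S' x > 0" "bary S' y > 0" "bary S' z > 0" "bary S' w > 0"
      "active S' {x, y}" "active S' {x, z}" "active S' {x, w}" "active S' {y, z}" "active S' {y, w}" "active S' {z, w}"
    for S' x y z w
  proof -
    interpret t: tetrahedron S' x y z w by (rule t)
    show ?thesis
      by (rule t.realizes_4_6_3_0) (use that(2-) in \<open>simp_all add: t.activity t.obtuse_sym\<close>)
  qed
  consider "bary S p > 0" "bary S q > 0" "bary S r > 0" "bary S s > 0"
    | "\<not> bary S p > 0" "bary S q > 0" "bary S r > 0" "bary S s > 0"
    | "\<not> bary S q > 0" "bary S p > 0" "bary S r > 0" "bary S s > 0"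
    | "\<not> bary S r > 0" "bary S p > 0" "bary S q > 0" "bary S s > 0"
    | "\<not> bary S s > 0" "bary S p > 0" "bary S q > 0" "bary S r > 0"
    using pos by blast
  then show ?thesis
  proof cases
    case 1
    then have "realizes S ((4, 6, 4, 1), None)"
      by (intro realizes_4_6_4_1) (simp_all add: activity acute)
    then show ?thesis by blast
  next
    case 2
    have "realizes S ((4, 6, 3, 0), None)"
      by (rule one_neg[of S p q r s]) (use 2 E any_perm in \<open>auto simp: insert_commute\<close>)
    then show ?thesis by blast
  next
    case 3
    have "realizes S ((4, 6, 3, 0), None)"
      by (rule one_neg[of S q p r s]) (use 3 E any_perm in \<open>auto simp: insert_commute\<close>)
    then show ?thesis by blast
  next
    case 4
    have "realizes S ((4, 6, 3, 0), None)"
      by (rule one_neg[of S r p q s]) (use 4 E any_perm in \<open>auto simp: insert_commute\<close>)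
    then show ?thesis by blast
  next
    case 5
    have "realizes S ((4, 6, 3, 0), None)"
      by (rule one_neg[of S s p q r]) (use 5 E any_perm in \<open>auto simp: insert_commute\<close>)
    then show ?thesis by blast
  qed
qed

text \<open>If l(p) or l(q) were not positive, the other three coordinates would be, and
  \<open>obtuse_neighbour\<close> would make the edge rs inactive. So both faces at rs are active,
  and the relation of pq leaves two options: the face pqs and the whole set are both active or both
  inactive.\<close>

lemma diamond_obtuse:
  assumes E: "active S {p, r}" "active S {p, s}" "active S {q, r}" "active S {q, s}" "active S {r, s}"
    and obt: "obtuse r p q"
  shows "\<exists>\<tau>. realizes S \<tau>"
proof -
  note acute = E[unfolded active_edges]
  have pos: "bary S q > 0 \<or> bary S s > 0" "bary S q > 0 \<or> bary S r > 0"
    "bary S p > 0 \<or> bary S s > 0" "bary S p > 0 \<or> bary S r > 0" "bary S p > 0 \<or> bary S q > 0"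
    and K: "\<not> bary S r > 0 \<or> (bary S s > 0) \<noteq> obtuse s p q"
    using obtuse_opposite_edges acute obt by blast+
  have "\<not> (\<not> bary S p > 0 \<and> bary S q > 0 \<and> bary S r > 0 \<and> bary S s > 0)"
    using obtuse_neighbour acute obt by blast
  moreover have "\<not> (\<not> bary S q > 0 \<and> bary S p > 0 \<and> bary S r > 0 \<and> bary S s > 0)"
    using tetrahedron.obtuse_neighbour[of S q p r s] any_perm[of q p r s] acute obt obtuse_sym by blast
  ultimately consider "bary S p > 0" "bary S q > 0" "bary S r > 0" "bary S s > 0" "\<not> obtuse s p q"
    | "bary S p > 0" "bary S q > 0" "\<not> bary S r > 0 \<or> obtuse s p q" "\<not> bary S r > 0 \<or> \<not> bary S s > 0"
    using pos K by blast
  then show ?thesis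
  proof cases
    case 1
    then have "realizes S ((4, 5, 3, 1), None)"
      by (intro realizes_4_5_3_1) (simp_all add: activity acute obt)
    then show ?thesis by blast
  next
    case 2
    then have "realizes S ((4, 5, 2, 0), None)"
      by (intro realizes_4_5_2_0) (use 2 in \<open>auto simp add: activity acute obt\<close>)
    then show ?thesis by blast
  qed
qed

lemma diamond_case:
  assumes E: "active S {p, r}" "active S {p, s}" "active S {q, r}" "active S {q, s}" "active S {r, s}"
    and "\<not> active S {p, q}"
  shows "\<exists>\<tau>. realizes S \<tau>"
proof -
  consider "obtuse r p q" | "obtuse s p q"
    using assms(6) unfolding active_edges by blast
  then show ?thesis
  proof cases
    case 1
    then show ?thesis by (rule diamond_obtuse[OF E])
  next
    case 2
    interpret t: tetrahedron S p q s r by (rule any_perm) auto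
    show ?thesis by (rule t.diamond_obtuse) (use E 2 in \<open>simp_all add: insert_commute\<close>)
  qed
qed

text \<open>The faces pqr and prs are obtuse. The face pqs is active iff its angle at s is not
  obtuse and l(r) > 0, and qrs iff its angle at q is not obtuse and l(p) > 0. The edge relations
  forbid that both fail, and make all coordinates positive if both hold.\<close>

lemma cycle_obtuse:
  assumes E: "active S {p, r}" "active S {p, s}" "active S {q, r}" "active S {q, s}"
    and obt: "obtuse r p q" "obtuse p r s"
  shows "\<exists>\<tau>. realizes S \<tau>"
proof -
  note acute = E[unfolded active_edges]
  have K: "bary S q > 0 \<or> bary S s > 0" "bary S q > 0 \<or> bary S r > 0"
    "bary S p > 0 \<or> bary S s > 0" "bary S p > 0 \<or> bary S r > 0"
    "\<not> bary S r > 0 \<or> (bary S s > 0) \<noteq> obtuse s p q"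
    "\<not> bary S p > 0 \<or> (bary S q > 0) \<noteq> obtuse q r s"
    using obtuse_opposite_edges acute obt by blast+
  consider "\<not> obtuse s p q" "\<not> obtuse q r s" "bary S p > 0" "bary S q > 0" "bary S r > 0" "bary S s > 0"
    | "\<not> obtuse q r s" "bary S p > 0" "obtuse s p q \<or> \<not> bary S r > 0" "\<not> bary S r > 0 \<or> \<not> bary S s > 0"
    | "\<not> obtuse s p q" "bary S r > 0" "obtuse q r s \<or> \<not> bary S p > 0" "\<not> bary S p > 0 \<or> \<not> bary S q > 0"
    using K by blast
  then show ?thesis
  proof cases
    case 1
    interpret t: tetrahedron S p r q s by (rule any_perm) auto
    have "realizes S ((4, 4, 2, 1), Some Cycle_O)"
      by (rule t.realizes_4_4_2_1_O) (use 1 acute obt in \<open>simp_all add: t.activity obtuse_sym\<close>)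
    then show ?thesis by blast
  next
    case 2
    interpret t: tetrahedron S p r q s by (rule any_perm) auto
    have "realizes S ((4, 4, 1, 0), Some Cycle_O)"
      by (rule t.realizes_4_4_1_0_O) (use 2 acute obt in \<open>auto simp: t.activity obtuse_sym\<close>)
    then show ?thesis by blast
  next
    case 3
    interpret t: tetrahedron S r p s q by (rule any_perm) auto
    have "realizes S ((4, 4, 1, 0), Some Cycle_O)"
      by (rule t.realizes_4_4_1_0_O) (use 3 acute obt in \<open>auto simp: t.activity obtuse_sym\<close>)
    then show ?thesis by blast
  qed
qed

text \<open>Each missing edge has an obtuse angle at one of two vertices; swapping p with q and r
  with s reduces the four combinations to one.\<close>

lemma cycle_case:
  assumes E: "active S {p, r}" "active S {p, s}" "active S {q, r}" "active S {q, s}"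
    and N: "\<not> active S {p, q}" "\<not> active S {r, s}"
  shows "\<exists>\<tau>. realizes S \<tau>"
proof -
  consider "obtuse r p q" "obtuse p r s" | "obtuse r p q" "obtuse q r s"
    | "obtuse s p q" "obtuse p r s" | "obtuse s p q" "obtuse q r s"
    using N unfolding active_edges by blast
  then show ?thesis
  proof cases
    case 1
    then show ?thesis by (rule cycle_obtuse[OF E])
  next
    case 2
    interpret t: tetrahedron S q p r s by (rule any_perm) auto
    show ?thesis by (rule t.cycle_obtuse) (use E 2 in \<open>simp_all add: obtuse_sym\<close>)
  next
    case 3
    interpret t: tetrahedron S p q s r by (rule any_perm) auto
    show ?thesis by (rule t.cycle_obtuse) (use E 3 in \<open>simp_all add: obtuse_sym\<close>)
  next
    case 4
    interpret t: tetrahedron S q p s r by (rule any_perm) auto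
    show ?thesis by (rule t.cycle_obtuse) (use E 4 in \<open>simp_all add: obtuse_sym\<close>)
  qed
qed

text \<open>One instance for each choice of the vertices in the roles of p and r in
  \<open>not_both_obtuse\<close>, with angles in the normal form of \<open>obtuse_sym\<close>, so
  that the propositional provers meet the same atoms everywhere.\<close>

lemma not_both_obtuse_all:
  "\<not> (bary S q > 0 \<and> bary S r > 0 \<and> bary S s > 0 \<and> (obtuse q p r \<or> obtuse r p q) \<and> (obtuse q p s \<or> obtuse s p q))"
  "\<not> (bary S r > 0 \<and> bary S q > 0 \<and> bary S s > 0 \<and> (obtuse r p q \<or> obtuse q p r) \<and> (obtuse r p s \<or> obtuse s p r))"
  "\<not> (bary S s > 0 \<and> bary S q > 0 \<and> bary S r > 0 \<and> (obtuse s p q \<or> obtuse q p s) \<and> (obtuse s p r \<or> obtuse r p s))"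
  "\<not> (bary S p > 0 \<and> bary S r > 0 \<and> bary S s > 0 \<and> (obtuse p q r \<or> obtuse r p q) \<and> (obtuse p q s \<or> obtuse s p q))"
  "\<not> (bary S r > 0 \<and> bary S p > 0 \<and> bary S s > 0 \<and> (obtuse r p q \<or> obtuse p q r) \<and> (obtuse r q s \<or> obtuse s q r))"
  "\<not> (bary S s > 0 \<and> bary S p > 0 \<and> bary S r > 0 \<and> (obtuse s p q \<or> obtuse p q s) \<and> (obtuse s q r \<or> obtuse r q s))"
  "\<not> (bary S p > 0 \<and> bary S q > 0 \<and> bary S s > 0 \<and> (obtuse p q r \<or> obtuse q p r) \<and> (obtuse p r s \<or> obtuse s p r))"
  "\<not> (bary S q > 0 \<and> bary S p > 0 \<and> bary S s > 0 \<and> (obtuse q p r \<or> obtuse p q r) \<and> (obtuse q r s \<or> obtuse s q r))"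
  "\<not> (bary S s > 0 \<and> bary S p > 0 \<and> bary S q > 0 \<and> (obtuse s p r \<or> obtuse p r s) \<and> (obtuse s q r \<or> obtuse q r s))"
  "\<not> (bary S p > 0 \<and> bary S q > 0 \<and> bary S r > 0 \<and> (obtuse p q s \<or> obtuse q p s) \<and> (obtuse p r s \<or> obtuse r p s))"
  "\<not> (bary S q > 0 \<and> bary S p > 0 \<and> bary S r > 0 \<and> (obtuse q p s \<or> obtuse p q s) \<and> (obtuse q r s \<or> obtuse r q s))"
  "\<not> (bary S r > 0 \<and> bary S p > 0 \<and> bary S q > 0 \<and> (obtuse r p s \<or> obtuse p r s) \<and> (obtuse r q s \<or> obtuse q r s))"
proof -
  note M = tetrahedron.not_both_obtuse[OF any_perm]
  show "\<not> (bary S q > 0 \<and> bary S r > 0 \<and> bary S s > 0 \<and> (obtuse q p r \<or> obtuse r p q) \<and> (obtuse q p s \<or> obtuse s p q))"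
    using M[of p r q s] by (auto simp: obtuse_sym)
  show "\<not> (bary S r > 0 \<and> bary S q > 0 \<and> bary S s > 0 \<and> (obtuse r p q \<or> obtuse q p r) \<and> (obtuse r p s \<or> obtuse s p r))"
    using M[of p q r s] by (auto simp: obtuse_sym)
  show "\<not> (bary S s > 0 \<and> bary S q > 0 \<and> bary S r > 0 \<and> (obtuse s p q \<or> obtuse q p s) \<and> (obtuse s p r \<or> obtuse r p s))"
    using M[of p q s r] by (auto simp: obtuse_sym)
  show "\<not> (bary S p > 0 \<and> bary S r > 0 \<and> bary S s > 0 \<and> (obtuse p q r \<or> obtuse r p q) \<and> (obtuse p q s \<or> obtuse s p q))"
    using M[of q r p s] by (auto simp: obtuse_sym)
  show "\<not> (bary S r > 0 \<and> bary S p > 0 \<and> bary S s > 0 \<and> (obtuse r p q \<or> obtuse p q r) \<and> (obtuse r q s \<or> obtuse s q r))"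
    using M[of q p r s] by (auto simp: obtuse_sym)
  show "\<not> (bary S s > 0 \<and> bary S p > 0 \<and> bary S r > 0 \<and> (obtuse s p q \<or> obtuse p q s) \<and> (obtuse s q r \<or> obtuse r q s))"
    using M[of q p s r] by (auto simp: obtuse_sym)
  show "\<not> (bary S p > 0 \<and> bary S q > 0 \<and> bary S s > 0 \<and> (obtuse p q r \<or> obtuse q p r) \<and> (obtuse p r s \<or> obtuse s p r))"
    using M[of r q p s] by (auto simp: obtuse_sym)
  show "\<not> (bary S q > 0 \<and> bary S p > 0 \<and> bary S s > 0 \<and> (obtuse q p r \<or> obtuse p q r) \<and> (obtuse q r s \<or> obtuse s q r))"
    using M[of r p q s] by (auto simp: obtuse_sym)
  show "\<not> (bary S s > 0 \<and> bary S p > 0 \<and> bary S q > 0 \<and> (obtuse s p r \<or> obtuse p r s) \<and> (obtuse s q r \<or> obtuse q r s))"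
    using M[of r p s q] by (auto simp: obtuse_sym)
  show "\<not> (bary S p > 0 \<and> bary S q > 0 \<and> bary S r > 0 \<and> (obtuse p q s \<or> obtuse q p s) \<and> (obtuse p r s \<or> obtuse r p s))"
    using M[of s q p r] by (auto simp: obtuse_sym)
  show "\<not> (bary S q > 0 \<and> bary S p > 0 \<and> bary S r > 0 \<and> (obtuse q p s \<or> obtuse p q s) \<and> (obtuse q r s \<or> obtuse r q s))"
    using M[of s p q r] by (auto simp: obtuse_sym)
  show "\<not> (bary S r > 0 \<and> bary S p > 0 \<and> bary S q > 0 \<and> (obtuse r p s \<or> obtuse p r s) \<and> (obtuse r q s \<or> obtuse q r s))"
    using M[of s p r q] by (auto simp: obtuse_sym)
qed

text \<open>A propositional question about angles and signs. For instance, l(s) <= 0 forces the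
  other coordinates to be positive; the obtuse angles over ps and qs, which cannot both lie in the
  face pqs, then violate \<open>not_both_obtuse_all\<close>.\<close>

lemma paw_case:
  assumes E: "active S {p, q}" "active S {p, r}" "active S {q, r}" "active S {r, s}"
    and N: "\<not> active S {p, s}" "\<not> active S {q, s}"
  shows "\<exists>\<tau>. realizes S \<tau>"
proof -
  note acute = E[unfolded active_edges] and obtuse = N[unfolded active_edges]
  have "realizes S ((4, 4, 1, 0), Some Paw_P)"
    by (rule realizes_4_4_1_0_P; unfold activity;
        use acute obtuse not_both_obtuse_all obtuse_unique obtuse_opposite_edges in satx)
  then show ?thesis by blast
qed

text \<open>Every face contains a missing edge, but the obtuse angle opposite to it may lie in the
  neighbouring face; the sign relations are what excludes the remaining faces. The same holds for
  the star.\<close>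

lemma path_case:
  assumes E: "active S {p, q}" "active S {q, r}" "active S {r, s}"
    and N: "\<not> active S {p, r}" "\<not> active S {p, s}" "\<not> active S {q, s}"
  shows "\<exists>\<tau>. realizes S \<tau>"
proof -
  note acute = E[unfolded active_edges] and obtuse = N[unfolded active_edges]
  have "realizes S ((4, 3, 0, 0), Some Path_L)"
    by (rule realizes_4_3_0_0_L; unfold activity;
        use acute obtuse not_both_obtuse_all obtuse_unique obtuse_opposite_edges in argo)
  then show ?thesis by blast
qed

lemma star_case:
  assumes E: "active S {p, q}" "active S {p, r}" "active S {p, s}"
    and N: "\<not> active S {q, r}" "\<not> active S {q, s}" "\<not> active S {r, s}"
  shows "\<exists>\<tau>. realizes S \<tau>"
proof -
  note acute = E[unfolded active_edges] and obtuse = N[unfolded active_edges]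
  have "realizes S ((4, 3, 0, 0), Some Star_T)"
    by (rule realizes_4_3_0_0_T; unfold activity;
        use acute obtuse not_both_obtuse_all obtuse_unique obtuse_opposite_edges in argo)
  then show ?thesis by blast
qed

text \<open>The graph is a cone with apex p over a graph on q, r, s, so up to relabelling only the
  number of edges among these three matters.\<close>

lemma dominating_case:
  assumes E: "active S {p, q}" "active S {p, r}" "active S {p, s}"
  shows "\<exists>\<tau>. realizes S \<tau>"
proof -
  show ?thesis
  proof (cases "active S {q, r}"; cases "active S {q, s}"; cases "active S {r, s}")
    assume "active S {q, r}" "active S {q, s}" "active S {r, s}"
    then show ?thesis using E by (intro complete_case)
  next
    assume "\<not> active S {q, r}" "active S {q, s}" "active S {r, s}"
    then show ?thesis using E
      by (intro tetrahedron.diamond_case[OF any_perm, of q r p s]) (auto simp: insert_commute)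
  next
    assume "active S {q, r}" "\<not> active S {q, s}" "active S {r, s}"
    then show ?thesis using E
      by (intro tetrahedron.diamond_case[OF any_perm, of q s p r]) (auto simp: insert_commute)
  next
    assume "active S {q, r}" "active S {q, s}" "\<not> active S {r, s}"
    then show ?thesis using E
      by (intro tetrahedron.diamond_case[OF any_perm, of r s p q]) (auto simp: insert_commute)
  next
    assume "active S {q, r}" "\<not> active S {q, s}" "\<not> active S {r, s}"
    then show ?thesis using E
      by (intro tetrahedron.paw_case[OF any_perm, of q r p s]) (auto simp: insert_commute)
  next
    assume "\<not> active S {q, r}" "active S {q, s}" "\<not> active S {r, s}"
    then show ?thesis using E
      by (intro tetrahedron.paw_case[OF any_perm, of q s p r]) (auto simp: insert_commute)
  next
    assume "\<not> active S {q, r}" "\<not> active S {q, s}" "active S {r, s}"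
    then show ?thesis using E
      by (intro tetrahedron.paw_case[OF any_perm, of r s p q]) (auto simp: insert_commute)
  next
    assume "\<not> active S {q, r}" "\<not> active S {q, s}" "\<not> active S {r, s}"
    then show ?thesis using E by (intro star_case)
  qed
qed

text \<open>Some active edge leaves s. Together with the path p-q-r it produces a vertex joined to
  all others, unless the graph is a cycle or a path.\<close>

lemma two_edges_case:
  assumes E: "active S {p, q}" "active S {q, r}"
  shows "\<exists>\<tau>. realizes S \<tau>"
proof -
  interpret s: tetrahedron S s p q r by (rule any_perm) auto
  consider "active S {q, s}"
    | "active S {p, s}" "active S {p, r}"
    | "active S {r, s}" "active S {p, r}"
    | "active S {p, s}" "active S {r, s}" "\<not> active S {p, r}" "\<not> active S {q, s}"
    | "active S {r, s}" "\<not> active S {p, s}" "\<not> active S {p, r}" "\<not> active S {q, s}"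
    | "active S {p, s}" "\<not> active S {r, s}" "\<not> active S {p, r}" "\<not> active S {q, s}"
    using s.active_edge_at unfolding insert_commute[of s] by blast
  then show ?thesis
  proof cases
    case 1
    then show ?thesis using E
      by (intro tetrahedron.dominating_case[OF any_perm, of q p r s]) (auto simp: insert_commute)
  next
    case 2
    then show ?thesis using E by (intro dominating_case)
  next
    case 3
    then show ?thesis using E
      by (intro tetrahedron.dominating_case[OF any_perm, of r p q s]) (auto simp: insert_commute)
  next
    case 4
    then show ?thesis using E
      by (intro tetrahedron.cycle_case[OF any_perm, of p r q s]) (auto simp: insert_commute)
  next
    case 5
    then show ?thesis using E by (intro path_case)
  next
    case 6
    then show ?thesis using E
      by (intro tetrahedron.path_case[OF any_perm, of s p q r]) (auto simp: insert_commute)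
  qed
qed

text \<open>An active edge across the cut between {p, q} and {r, s} meets the given one.\<close>

lemma one_edge_case:
  assumes E: "active S {p, q}"
  shows "\<exists>\<tau>. realizes S \<tau>"
proof -
  consider "active S {p, r}" | "active S {p, s}" | "active S {q, r}" | "active S {q, s}"
    using active_edge_across by blast
  then show ?thesis
  proof cases
    case 1
    then show ?thesis using E
      by (intro tetrahedron.two_edges_case[OF any_perm, of q p r s]) (auto simp: insert_commute)
  next
    case 2
    then show ?thesis using E
      by (intro tetrahedron.two_edges_case[OF any_perm, of q p s r]) (auto simp: insert_commute)
  next
    case 3
    then show ?thesis using E by (intro two_edges_case)
  next
    case 4
    then show ?thesis using E
      by (intro tetrahedron.two_edges_case[OF any_perm, of p q s r]) (auto simp: insert_commute)
  qed
qed

theorem classification: "\<exists>\<tau>. realizes S \<tau>"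
proof -
  consider "active S {p, q}" | "active S {p, r}" | "active S {p, s}"
    using active_edge_at by blast
  then show ?thesis
  proof cases
    case 1
    then show ?thesis by (rule one_edge_case)
  next
    case 2
    then show ?thesis
      by (intro tetrahedron.one_edge_case[OF any_perm, of p r q s]) (auto simp: insert_commute)
  next
    case 3
    then show ?thesis
      by (intro tetrahedron.one_edge_case[OF any_perm, of p s q r]) (auto simp: insert_commute)
  qed
qed

end

section \<open>Types\<close>

lemma fst_models: "fst ` models = nine_types"
  by (simp add: models_def nine_types_def)

lemma models_functional: "(\<tau>, M) \<in> models \<Longrightarrow> (\<tau>, M') \<in> models \<Longrightarrow> M = M'"
  unfolding models_def by (elim insertE emptyE; simp)

lemma generic_tetrahedron:
  assumes "generic S" "p \<in> S" "q \<in> S" "p \<noteq> q"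
  obtains r s where "tetrahedron S p q r s"
proof -
  have "card (S - {p, q}) = 2"
    using assms generic_finite[OF assms(1)] by (simp add: generic_def card_Diff_subset)
  then obtain r s where "S - {p, q} = {r, s}" by (auto simp: card_2_iff)
  then have "S = {p, q, r, s}" using assms by blast
  then show ?thesis using that assms(1) by (simp add: tetrahedron_def)
qed

lemma gabriel_edges_eq:
  assumes "generic S"
  shows "gabriel_edges S = {A \<in> morse_poset S. card A = 2}"
proof -
  have "cball (midpoint p q) (dist p q / 2) \<inter> S = {p, q} \<longleftrightarrow> active S {p, q}"
    if pq: "p \<in> S" "q \<in> S" "p \<noteq> q" for p q
  proof -
    obtain r s where "tetrahedron S p q r s" using generic_tetrahedron[OF assms pq] .
    then interpret tetrahedron S p q r s .
    show ?thesis unfolding gabriel_edge active_edge ..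
  qed
  then have "gabriel_edges S = {{p, q} | p q. p \<in> S \<and> q \<in> S \<and> p \<noteq> q \<and> active S {p, q}}"
    unfolding gabriel_edges_def by blast
  also have "\<dots> = {A \<in> morse_poset S. card A = 2}"
    unfolding morse_poset_def card_2_iff by (auto simp: active_def)
  finally show ?thesis .
qed

lemma model_faces:
  assumes "(\<tau>, M) \<in> models"
  shows "M \<subseteq> Pow {1..4}"
  using assms unfolding models_def atLeast1AtMost4 by auto

lemma morse_poset_layer:
  assumes "bij_betw f {1..4} S" "(\<lambda>A. f ` A) ` M = morse_poset S" "M \<subseteq> Pow {1..4::nat}"
  shows "{A \<in> morse_poset S. card A = k} = (\<lambda>A. f ` A) ` {A \<in> M. card A = k}"
    "card {A \<in> morse_poset S. card A = k} = card {A \<in> M. card A = k}"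
proof -
  have inj: "inj_on f {1..4}" using assms(1) by (simp add: bij_betw_def)
  have "card (f ` A) = card A" if "A \<in> M" for A
    using that assms(3) by (intro card_image inj_on_subset[OF inj]) auto
  then show *: "{A \<in> morse_poset S. card A = k} = (\<lambda>A. f ` A) ` {A \<in> M. card A = k}"
    unfolding assms(2)[symmetric] by auto
  have "inj_on ((`) f) {A \<in> M. card A = k}"
    by (rule inj_on_subset[OF inj_on_image_Pow[OF inj]]) (use assms(3) in auto)
  then show "card {A \<in> morse_poset S. card A = k} = card {A \<in> M. card A = k}"
    unfolding * by (rule card_image)
qed

text \<open>The two-point layer of a family with a letter equals \<open>letter_edges\<close>
  literally, so a labelling of the poset is also a labelling of the Gabriel graph.\<close>

lemma models_type:
  assumes "(\<tau>, M) \<in> models"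
  shows "fst \<tau> = (card {A \<in> M. card A = 1}, card {A \<in> M. card A = 2}, card {A \<in> M. card A = 3}, card {A \<in> M. card A = 4})
    \<and> (if card {A \<in> M. card A = 2} \<in> {3, 4} then \<exists>l. snd \<tau> = Some l \<and> {A \<in> M. card A = 2} = letter_edges l
       else snd \<tau> = None)"
  using assms unfolding models_def
  by (elim insertE emptyE Pair_inject; hypsubst;
      simp only: Collect_mem_insert fst_conv snd_conv; simp add: set_eq_subset)

lemma realizes_has_type:
  assumes "generic S" "realizes S \<tau>"
  shows "has_type S \<tau>"
proof -
  obtain M f where M: "(\<tau>, M) \<in> models" and f: "bij_betw f {1..4} S" "(\<lambda>A. f ` A) ` M = morse_poset S"
    using assms(2) unfolding realizes_def has_model_def by blast
  note layer = morse_poset_layer[OF f model_faces[OF M]]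
  have num: "num_active S 0 = card {A \<in> M. card A = 1}" "num_active S 1 = card {A \<in> M. card A = 2}"
    "num_active S 2 = card {A \<in> M. card A = 3}" "num_active S 3 = card {A \<in> M. card A = 4}"
    unfolding num_active_def layer(2) by (simp_all add: eval_nat_numeral)
  have letter: "gabriel_letter S l" if "{A \<in> M. card A = 2} = letter_edges l" for l
    using f(1) layer(1)[of 2] that unfolding gabriel_letter_def gabriel_edges_eq[OF assms(1)] by metis
  show ?thesis
    using models_type[OF M] letter unfolding has_type_def num by (auto split: if_splits)
qed

text \<open>The number of edges and the existence of a vertex joined to all others suffice to tell
  the four letters apart.\<close>

lemma gabriel_letter_invariants:
  assumes "gabriel_letter S l"
  shows "card (gabriel_edges S) = card (letter_edges l)"
    and "(\<exists>v\<in>S. \<forall>w\<in>S. w \<noteq> v \<longrightarrow> {v, w} \<in> gabriel_edges S)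
      \<longleftrightarrow> (\<exists>v\<in>{1..4}. \<forall>w\<in>{1..4}. w \<noteq> v \<longrightarrow> {v, w} \<in> letter_edges l)"
proof -
  obtain f where f: "bij_betw f {1..4::nat} S" and E: "(\<lambda>e. f ` e) ` letter_edges l = gabriel_edges S"
    using assms unfolding gabriel_letter_def by blast
  have inj: "inj_on f {1..4}" and S: "S = f ` {1..4}" using f by (auto simp: bij_betw_def)
  have sub: "letter_edges l \<subseteq> Pow {1..4}"
    by (cases l) (auto simp: atLeast1AtMost4)
  have injP: "inj_on ((`) f) (Pow {1..4})" by (rule inj_on_image_Pow[OF inj])
  show "card (gabriel_edges S) = card (letter_edges l)"
    unfolding E[symmetric] by (rule card_image[OF inj_on_subset[OF injP sub]])
  have edge: "{f v, f w} \<in> gabriel_edges S \<longleftrightarrow> {v, w} \<in> letter_edges l" if "v \<in> {1..4}" "w \<in> {1..4}" for v w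
    using inj_on_image_mem_iff[OF injP _ sub, of "{v, w}"] that unfolding E[symmetric] by simp
  have neq: "f w \<noteq> f v \<longleftrightarrow> w \<noteq> v" if "v \<in> {1..4}" "w \<in> {1..4}" for v w
    using inj_on_eq_iff[OF inj that(2,1)] by simp
  have *: "(\<exists>v\<in>S. \<forall>w\<in>S. w \<noteq> v \<longrightarrow> {v, w} \<in> E)
      \<longleftrightarrow> (\<exists>v\<in>{1..4}. \<forall>w\<in>{1..4}. f w \<noteq> f v \<longrightarrow> {f v, f w} \<in> E)"
    for E by (simp add: S)
  have "(\<exists>v\<in>S. \<forall>w\<in>S. w \<noteq> v \<longrightarrow> {v, w} \<in> gabriel_edges S)
      \<longleftrightarrow> (\<exists>v\<in>{1..4}. \<forall>w\<in>{1..4}. f w \<noteq> f v \<longrightarrow> {f v, f w} \<in> gabriel_edges S)"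
    by (rule *)
  also have "\<dots> \<longleftrightarrow> (\<exists>v\<in>{1..4}. \<forall>w\<in>{1..4}. w \<noteq> v \<longrightarrow> {v, w} \<in> letter_edges l)"
    by (intro bex_cong ball_cong refl) (simp only: edge neq)
  finally show "(\<exists>v\<in>S. \<forall>w\<in>S. w \<noteq> v \<longrightarrow> {v, w} \<in> gabriel_edges S)
      \<longleftrightarrow> (\<exists>v\<in>{1..4}. \<forall>w\<in>{1..4}. w \<noteq> v \<longrightarrow> {v, w} \<in> letter_edges l)" .
qed

lemma letter_unique:
  assumes "gabriel_letter S l" "gabriel_letter S l'"
  shows "l = l'"
proof -
  let ?dom = "\<lambda>l. \<exists>v\<in>{1..4}. \<forall>w\<in>{1..4}. w \<noteq> v \<longrightarrow> {v, w} \<in> letter_edges l"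
  have "(card (letter_edges l), ?dom l) = (case l of Cycle_O \<Rightarrow> (4, False) | Paw_P \<Rightarrow> (4, True)
      | Path_L \<Rightarrow> (3, False) | Star_T \<Rightarrow> (3, True))" for l
    unfolding atLeast1AtMost4 by (cases l) (simp_all add: doubleton_eq_iff)
  moreover have "(card (letter_edges l), ?dom l) = (card (letter_edges l'), ?dom l')"
    using gabriel_letter_invariants[OF assms(1)] gabriel_letter_invariants[OF assms(2)] by simp
  ultimately have "(case l of Cycle_O \<Rightarrow> (4::nat, False) | Paw_P \<Rightarrow> (4, True) | Path_L \<Rightarrow> (3, False) | Star_T \<Rightarrow> (3, True))
    = (case l' of Cycle_O \<Rightarrow> (4, False) | Paw_P \<Rightarrow> (4, True) | Path_L \<Rightarrow> (3, False) | Star_T \<Rightarrow> (3, True))"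
    by simp
  then show ?thesis by (simp split: graph_letter.splits)
qed

lemma has_type_unique:
  assumes "has_type S \<tau>" "has_type S \<tau>'"
  shows "\<tau> = \<tau>'"
  using assms letter_unique unfolding has_type_def by (auto simp: prod_eq_iff split: if_splits)

text \<open>Labellings compose with bijections of the point sets, and two labellings by the same
  family differ by such a bijection.\<close>

lemma combinatorially_equivalent_iff:
  assumes "has_model S M" "M \<subseteq> Pow {1..4}"
  shows "combinatorially_equivalent S S' \<longleftrightarrow> has_model S' M"
proof -
  obtain f where f: "bij_betw f {1..4} S" "(\<lambda>A. f ` A) ` M = morse_poset S"
    using assms(1) unfolding has_model_def by blast
  show ?thesis
  proof
    assume "combinatorially_equivalent S S'"
    then obtain g where g: "bij_betw g S S'" "(\<lambda>A. g ` A) ` morse_poset S = morse_poset S'"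
      unfolding combinatorially_equivalent_def by blast
    have "(\<lambda>A. (g \<circ> f) ` A) ` M = morse_poset S'"
      unfolding g(2)[symmetric] f(2)[symmetric] by (simp add: image_image image_comp)
    then show "has_model S' M"
      unfolding has_model_def using bij_betw_trans[OF f(1) g(1)] by blast
  next
    assume "has_model S' M"
    then obtain g where g: "bij_betw g {1..4} S'" "(\<lambda>A. g ` A) ` M = morse_poset S'"
      unfolding has_model_def by blast
    let ?h = "the_inv_into {1..4} f"
    have "(g \<circ> ?h) ` f ` B = g ` B" if "B \<in> M" for B
    proof -
      have "B \<subseteq> {1..4}" using that assms(2) by blast
      then have "?h (f i) = i" if "i \<in> B" for i
        using that f(1) by (intro the_inv_into_f_f) (auto simp: bij_betw_def)
      then show ?thesis by (simp add: image_image)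
    qed
    then have "(\<lambda>A. (g \<circ> ?h) ` A) ` morse_poset S = morse_poset S'"
      unfolding f(2)[symmetric] g(2)[symmetric] image_image[of "(`) (g \<circ> ?h)"] by (rule image_cong[OF refl])
    moreover have "bij_betw (g \<circ> ?h) S S'"
      using bij_betw_trans[OF bij_betw_the_inv_into[OF f(1)] g(1)] .
    ultimately show "combinatorially_equivalent S S'"
      unfolding combinatorially_equivalent_def by blast
  qed
qed

section \<open>Examples\<close>

lemma genericI:
  assumes card: "card S = 4" and indep: "\<not> affine_dependent S"
    and right: "\<And>x y z. \<lbrakk>x \<in> S; y \<in> S; z \<in> S; x \<noteq> y; x \<noteq> z; y \<noteq> z\<rbrakk> \<Longrightarrow> (x - z) \<bullet> (y - z) \<noteq> 0"
    and sphere: "S \<subseteq> sphere X R"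
    and coords: "sum l S = 1" "(\<Sum>x\<in>S. l x *\<^sub>R x) = X" "\<And>x. x \<in> S \<Longrightarrow> l x \<noteq> 0"
  shows "generic S" "circumcenter S = X"
proof -
  have fin: "finite S" using card by (metis card.infinite zero_neq_numeral)
  have "X \<in> affine hull S" unfolding affine_hull_finite[OF fin] using coords(1,2) by blast
  then show cX: "circumcenter S = X" using sphere by (rule circumcenter_eqI)
  have "aff_dim S = 3" using aff_dim_affine_independent[OF indep] card by simp
  moreover have "circumcenter A \<notin> closed_segment x y"
    if A: "A \<subseteq> S" "card A = 3" and xy: "x \<in> A" "y \<in> A" "x \<noteq> y" for A x y
  proof
    assume seg: "circumcenter A \<in> closed_segment x y"
    have "finite A" using A fin finite_subset by blast
    have "card (A - {x, y}) = 1" using A(2) xy \<open>finite A\<close> by (simp add: card_Diff_subset)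
    then obtain z where "A - {x, y} = {z}" by (auto simp: card_1_singleton_iff)
    then have Az: "A = {x, y, z}" "z \<noteq> x" "z \<noteq> y" using xy by auto
    have indA: "\<not> affine_dependent {x, y, z}" using affine_dependent_subset[OF _ A(1)] indep Az by blast
    obtain w where w: "w > 0"
      "circumcenter {x, y, z} = ((dist y z)\<^sup>2 * ((y - x) \<bullet> (z - x)) * w) *\<^sub>R x
        + ((dist x z)\<^sup>2 * ((x - y) \<bullet> (z - y)) * w) *\<^sub>R y
        + ((dist x y)\<^sup>2 * ((x - z) \<bullet> (y - z)) * w) *\<^sub>R z"
      "(dist y z)\<^sup>2 * ((y - x) \<bullet> (z - x)) * w + (dist x z)\<^sup>2 * ((x - y) \<bullet> (z - y)) * w
        + (dist x y)\<^sup>2 * ((x - z) \<bullet> (y - z)) * w = 1"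
      using circumcenter_triangle[OF indA] A(2) unfolding Az(1) by metis
    define a b d where "a = (dist y z)\<^sup>2 * ((y - x) \<bullet> (z - x)) * w"
      and "b = (dist x z)\<^sup>2 * ((x - y) \<bullet> (z - y)) * w"
      and "d = (dist x y)\<^sup>2 * ((x - z) \<bullet> (y - z)) * w"
    have c: "circumcenter {x, y, z} = a *\<^sub>R x + b *\<^sub>R y + d *\<^sub>R z" "a + b + d = 1"
      using w(2,3) by (simp_all add: a_def b_def d_def)
    obtain u where u: "circumcenter {x, y, z} = (1 - u) *\<^sub>R x + u *\<^sub>R y"
      using seg unfolding closed_segment_def Az(1) by blast
    \<comment> \<open>The two sides are the coefficients of z: \<open>d\<close> on the left, 0 on
      the right.\<close>
    have "(if z = x then a else if z = y then b else d) = (if z = x then 1 - u else if z = y then u else 0)"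
      by (rule affine_coordinates_unique[OF indA, of "\<lambda>v. if v = x then a else if v = y then b else d"
            "\<lambda>v. if v = x then 1 - u else if v = y then u else 0" z])
        (use c u Az xy in \<open>auto simp: add.assoc\<close>)
    then have "d = 0" using Az by simp
    moreover have "(x - z) \<bullet> (y - z) \<noteq> 0" using right[of x y z] A Az xy by auto
    ultimately show False using w(1) xy by (simp add: d_def)
  qed
  moreover have "circumcenter S \<notin> affine hull A" if A: "A \<subseteq> S" "card A = 3" for A
  proof
    assume "circumcenter S \<in> affine hull A"
    then obtain m where m: "sum m A = 1" "(\<Sum>x\<in>A. m x *\<^sub>R x) = X"
      unfolding cX affine_hull_finite[OF finite_subset[OF A(1) fin]] by blast
    have "A \<noteq> S" using A card by auto
    then obtain x where x: "x \<in> S" "x \<notin> A" using A by blast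
    define m' where "m' = (\<lambda>v. if v \<in> A then m v else 0)"
    have m': "sum m' S = sum m A" "(\<Sum>x\<in>S. m' x *\<^sub>R x) = (\<Sum>x\<in>A. m x *\<^sub>R x)"
      using A(1) fin unfolding m'_def
      by (auto simp: if_distribR sum.If_cases Int_absorb1 if_distrib[of "\<lambda>t. t *\<^sub>R _"] cong: if_cong)
    have "l x = m' x"
      by (rule affine_coordinates_unique[OF indep fin _ _ x(1), of l m']) (simp_all only: m m' coords)
    then show False using coords(3)[OF x(1)] x(2) by (simp add: m'_def)
  qed
  ultimately show "generic S"
    unfolding generic_def using card by (simp add: aff_dim_convex_hull)
qed

text \<open>The triangular shape reduces affine independence to nonzero diagonal entries. The
  assumption \<open>eq\<close> is 2 v . X = v . v for v = q, r, s, that is, X = (x, y, z) is as far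
  from v as from the origin p. In the examples x, y, z solve these equations, and the weights follow
  by back substitution.\<close>

lemma coordinate_tetrahedron:
  fixes a b c e f g x y z l\<^sub>1 l\<^sub>2 l\<^sub>3 l\<^sub>4 :: real
  defines "p \<equiv> (0 :: point)" and "q \<equiv> vector [a, 0, 0]" and "r \<equiv> vector [b, c, 0]" and "s \<equiv> vector [e, f, g]"
  assumes ne: "a \<noteq> 0" "c \<noteq> 0" "g \<noteq> 0"
    and right: "\<And>u v w. \<lbrakk>u \<in> {p, q, r, s}; v \<in> {p, q, r, s}; w \<in> {p, q, r, s}; u \<noteq> v; u \<noteq> w; v \<noteq> w\<rbrakk>
      \<Longrightarrow> (u - w) \<bullet> (v - w) \<noteq> 0"
    and eq: "2 * (a * x) = a * a" "2 * (b * x + c * y) = b * b + c * c"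
      "2 * (e * x + f * y + g * z) = e * e + f * f + g * g"
    and l: "l\<^sub>1 + l\<^sub>2 + l\<^sub>3 + l\<^sub>4 = 1" "l\<^sub>2 * a + l\<^sub>3 * b + l\<^sub>4 * e = x" "l\<^sub>3 * c + l\<^sub>4 * f = y" "l\<^sub>4 * g = z"
      "l\<^sub>1 \<noteq> 0" "l\<^sub>2 \<noteq> 0" "l\<^sub>3 \<noteq> 0" "l\<^sub>4 \<noteq> 0"
  shows "tetrahedron {p, q, r, s} p q r s \<and> bary {p, q, r, s} p = l\<^sub>1 \<and> bary {p, q, r, s} q = l\<^sub>2
    \<and> bary {p, q, r, s} r = l\<^sub>3 \<and> bary {p, q, r, s} s = l\<^sub>4"
proof -
  note vec = vec_eq_iff forall_3 vector_3 inner_vec_def sum_3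
  have dist: "p \<noteq> q" "p \<noteq> r" "p \<noteq> s" "q \<noteq> r" "q \<noteq> s" "r \<noteq> s"
    using ne by (auto simp: p_def q_def r_def s_def vec)
  let ?S = "{p, q, r, s}" and ?X = "vector [x, y, z] :: point"
  have "u v = 0" if "sum u ?S = 0" "(\<Sum>v\<in>?S. u v *\<^sub>R v) = 0" "v \<in> ?S" for u v
  proof -
    have "u p + u q + u r + u s = 0" using that(1) dist by (simp add: add.assoc)
    moreover have "u q *\<^sub>R q + u r *\<^sub>R r + u s *\<^sub>R s = 0" using that(2) dist by (simp add: add.assoc p_def)
    then have "u q * a + u r * b + u s * e = 0" "u r * c + u s * f = 0" "u s * g = 0"
      by (auto simp: q_def r_def s_def vec)
    ultimately show ?thesis using ne that(3) by auto
  qed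
  then have indep: "\<not> affine_dependent ?S"
    by (subst affine_dependent_explicit_finite) blast+
  define m where "m = (\<lambda>v. if v = p then l\<^sub>1 else if v = q then l\<^sub>2 else if v = r then l\<^sub>3 else l\<^sub>4)"
  have m: "sum m ?S = 1" "(\<Sum>v\<in>?S. m v *\<^sub>R v) = ?X" "\<And>v. v \<in> ?S \<Longrightarrow> m v \<noteq> 0"
    using dist l by (auto simp: m_def p_def q_def r_def s_def vec)
  have "dist ?X v = dist ?X p" if "v \<in> ?S" for v
  proof -
    have "2 * (v \<bullet> ?X) = v \<bullet> v"
      using that eq by (auto simp: p_def q_def r_def s_def vec)
    then have "(dist ?X v)\<^sup>2 = (dist ?X p)\<^sup>2"
      unfolding dist_norm power2_norm_eq_inner p_def by (simp add: inner_diff_left inner_diff_right inner_commute)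
    then show ?thesis by simp
  qed
  then have sph: "?S \<subseteq> sphere ?X (dist ?X p)"
    unfolding subset_iff mem_sphere by blast
  have "card ?S = 4" using dist by simp
  note gen = genericI[OF this indep right sph m]
  then have "tetrahedron ?S p q r s" by unfold_locales simp_all
  moreover have "bary ?S v = m v" if "v \<in> ?S" for v
    using bary_unique[OF gen(1) m(1) _ that] m(2) gen(2) by simp
  ultimately show ?thesis
    using dist by (simp add: m_def)
qed

text \<open>Opposite edges have equal squared lengths 9, 8 and 5, and the circumcenter is the
  centroid.\<close>

lemma example_4_6_4_1: "\<exists>S. generic S \<and> realizes S ((4, 6, 4, 1), None)"
proof -
  note ex = coordinate_tetrahedron[where a = "3" and c = "2" and g = "2" and b = "2" and e = "1" and f = "0" and x = "3/2" and y = "1/2" and z = "1/2" and l\<^sub>1 = "1/4" and l\<^sub>2 = "1/4" and l\<^sub>3 = "1/4" and l\<^sub>4 = "1/4"]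
  let ?p = "0 :: point" and ?q = "vector [3, 0, 0] :: point" and ?r = "vector [2, 2, 0] :: point" and ?s = "vector [1, 0, 2] :: point"
  let ?S = "{?p, ?q, ?r, ?s}"
  have *: "tetrahedron ?S ?p ?q ?r ?s \<and> bary ?S ?p = 1/4 \<and> bary ?S ?q = 1/4 \<and> bary ?S ?r = 1/4 \<and> bary ?S ?s = 1/4"
    by (rule ex) (auto simp: inner_vec_def sum_3 vector_3)
  then interpret t: tetrahedron ?S ?p ?q ?r ?s by blast
  have "realizes ?S ((4, 6, 4, 1), None)"
    by (rule t.realizes_4_6_4_1; unfold t.activity obtuse_def) (use * in \<open>simp_all add: inner_vec_def sum_3 vector_3\<close>)
  then show ?thesis using t.generic by blast
qed

text \<open>All face angles are acute, and the circumcenter lies slightly beyond the face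
  qrs.\<close>

lemma example_4_6_3_0: "\<exists>S. generic S \<and> realizes S ((4, 6, 3, 0), None)"
proof -
  note ex = coordinate_tetrahedron[where a = "3" and c = "4" and g = "4" and b = "1" and e = "1" and f = "0" and x = "3/2" and y = "7/4" and z = "7/4" and l\<^sub>1 = "-1/12" and l\<^sub>2 = "5/24" and l\<^sub>3 = "7/16" and l\<^sub>4 = "7/16"]
  let ?p = "0 :: point" and ?q = "vector [3, 0, 0] :: point" and ?r = "vector [1, 4, 0] :: point" and ?s = "vector [1, 0, 4] :: point"
  let ?S = "{?p, ?q, ?r, ?s}"
  have *: "tetrahedron ?S ?p ?q ?r ?s \<and> bary ?S ?p = -1/12 \<and> bary ?S ?q = 5/24 \<and> bary ?S ?r = 7/16 \<and> bary ?S ?s = 7/16"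
    by (rule ex) (auto simp: inner_vec_def sum_3 vector_3)
  then interpret t: tetrahedron ?S ?p ?q ?r ?s by blast
  have "realizes ?S ((4, 6, 3, 0), None)"
    by (rule t.realizes_4_6_3_0; unfold t.activity obtuse_def) (use * in \<open>simp_all add: inner_vec_def sum_3 vector_3\<close>)
  then show ?thesis using t.generic by blast
qed

text \<open>The angle at r over pq is the only obtuse one, and the circumcenter is interior.\<close>

lemma example_4_5_3_1: "\<exists>S. generic S \<and> realizes S ((4, 5, 3, 1), None)"
proof -
  note ex = coordinate_tetrahedron[where a = "6" and c = "2" and g = "5" and b = "2" and e = "4" and f = "-3" and x = "3" and y = "-1" and z = "2" and l\<^sub>1 = "3/10" and l\<^sub>2 = "1/5" and l\<^sub>3 = "1/10" and l\<^sub>4 = "2/5"]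
  let ?p = "0 :: point" and ?q = "vector [6, 0, 0] :: point" and ?r = "vector [2, 2, 0] :: point" and ?s = "vector [4, -3, 5] :: point"
  let ?S = "{?p, ?q, ?r, ?s}"
  have *: "tetrahedron ?S ?p ?q ?r ?s \<and> bary ?S ?p = 3/10 \<and> bary ?S ?q = 1/5 \<and> bary ?S ?r = 1/10 \<and> bary ?S ?s = 2/5"
    by (rule ex) (auto simp: inner_vec_def sum_3 vector_3)
  then interpret t: tetrahedron ?S ?p ?q ?r ?s by blast
  have "realizes ?S ((4, 5, 3, 1), None)"
    by (rule t.realizes_4_5_3_1; unfold t.activity obtuse_def) (use * in \<open>simp_all add: inner_vec_def sum_3 vector_3\<close>)
  then show ?thesis using t.generic by blast
qed

text \<open>Both r and s see the long edge pq under an obtuse angle; their coordinates are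
  negative.\<close>

lemma example_4_5_2_0: "\<exists>S. generic S \<and> realizes S ((4, 5, 2, 0), None)"
proof -
  note ex = coordinate_tetrahedron[where a = "4" and c = "1" and g = "1" and b = "2" and e = "2" and f = "0" and x = "2" and y = "-3/2" and z = "-3/2" and l\<^sub>1 = "2" and l\<^sub>2 = "2" and l\<^sub>3 = "-3/2" and l\<^sub>4 = "-3/2"]
  let ?p = "0 :: point" and ?q = "vector [4, 0, 0] :: point" and ?r = "vector [2, 1, 0] :: point" and ?s = "vector [2, 0, 1] :: point"
  let ?S = "{?p, ?q, ?r, ?s}"
  have *: "tetrahedron ?S ?p ?q ?r ?s \<and> bary ?S ?p = 2 \<and> bary ?S ?q = 2 \<and> bary ?S ?r = -3/2 \<and> bary ?S ?s = -3/2"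
    by (rule ex) (auto simp: inner_vec_def sum_3 vector_3)
  then interpret t: tetrahedron ?S ?p ?q ?r ?s by blast
  have "realizes ?S ((4, 5, 2, 0), None)"
    by (rule t.realizes_4_5_2_0; unfold t.activity obtuse_def) (use * in \<open>simp_all add: inner_vec_def sum_3 vector_3\<close>)
  then show ?thesis using t.generic by blast
qed

text \<open>The obtuse angles are at q over pr and at p over qs, and the circumcenter is
  interior.\<close>

lemma example_4_4_2_1_O: "\<exists>S. generic S \<and> realizes S ((4, 4, 2, 1), Some Cycle_O)"
proof -
  note ex = coordinate_tetrahedron[where a = "1" and c = "3" and g = "2" and b = "2" and e = "-1" and f = "2" and x = "1/2" and y = "11/6" and z = "2/3" and l\<^sub>1 = "2/9" and l\<^sub>2 = "1/18" and l\<^sub>3 = "7/18" and l\<^sub>4 = "1/3"]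
  let ?p = "0 :: point" and ?q = "vector [1, 0, 0] :: point" and ?r = "vector [2, 3, 0] :: point" and ?s = "vector [-1, 2, 2] :: point"
  let ?S = "{?p, ?q, ?r, ?s}"
  have *: "tetrahedron ?S ?p ?q ?r ?s \<and> bary ?S ?p = 2/9 \<and> bary ?S ?q = 1/18 \<and> bary ?S ?r = 7/18 \<and> bary ?S ?s = 1/3"
    by (rule ex) (auto simp: inner_vec_def sum_3 vector_3)
  then interpret t: tetrahedron ?S ?p ?q ?r ?s by blast
  have "realizes ?S ((4, 4, 2, 1), Some Cycle_O)"
    by (rule t.realizes_4_4_2_1_O; unfold t.activity obtuse_def) (use * in \<open>simp_all add: inner_vec_def sum_3 vector_3\<close>)
  then show ?thesis using t.generic by blast
qed

text \<open>The obtuse angles are placed as in \<open>example_4_4_2_1_O\<close>, but the negative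
  coordinate of q deactivates the face prs.\<close>

lemma example_4_4_1_0_O: "\<exists>S. generic S \<and> realizes S ((4, 4, 1, 0), Some Cycle_O)"
proof -
  note ex = coordinate_tetrahedron[where a = "1" and c = "3" and g = "1" and b = "3" and e = "-1" and f = "4" and x = "1/2" and y = "5/2" and z = "-1/2" and l\<^sub>1 = "9/2" and l\<^sub>2 = "-9/2" and l\<^sub>3 = "3/2" and l\<^sub>4 = "-1/2"]
  let ?p = "0 :: point" and ?q = "vector [1, 0, 0] :: point" and ?r = "vector [3, 3, 0] :: point" and ?s = "vector [-1, 4, 1] :: point"
  let ?S = "{?p, ?q, ?r, ?s}"
  have *: "tetrahedron ?S ?p ?q ?r ?s \<and> bary ?S ?p = 9/2 \<and> bary ?S ?q = -9/2 \<and> bary ?S ?r = 3/2 \<and> bary ?S ?s = -1/2"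
    by (rule ex) (auto simp: inner_vec_def sum_3 vector_3)
  then interpret t: tetrahedron ?S ?p ?q ?r ?s by blast
  have "realizes ?S ((4, 4, 1, 0), Some Cycle_O)"
    by (rule t.realizes_4_4_1_0_O; unfold t.activity obtuse_def) (use * in \<open>simp_all add: inner_vec_def sum_3 vector_3\<close>)
  then show ?thesis using t.generic by blast
qed

text \<open>The triangle pqr is acute, and s lies beyond r: both angles at r that involve s are
  obtuse.\<close>

lemma example_4_4_1_0_P: "\<exists>S. generic S \<and> realizes S ((4, 4, 1, 0), Some Paw_P)"
proof -
  note ex = coordinate_tetrahedron[where a = "3" and c = "2" and g = "1" and b = "1" and e = "-2" and f = "5" and x = "3/2" and y = "1/2" and z = "31/2" and l\<^sub>1 = "1/3" and l\<^sub>2 = "71/3" and l\<^sub>3 = "-77/2" and l\<^sub>4 = "31/2"]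
  let ?p = "0 :: point" and ?q = "vector [3, 0, 0] :: point" and ?r = "vector [1, 2, 0] :: point" and ?s = "vector [-2, 5, 1] :: point"
  let ?S = "{?p, ?q, ?r, ?s}"
  have *: "tetrahedron ?S ?p ?q ?r ?s \<and> bary ?S ?p = 1/3 \<and> bary ?S ?q = 71/3 \<and> bary ?S ?r = -77/2 \<and> bary ?S ?s = 31/2"
    by (rule ex) (auto simp: inner_vec_def sum_3 vector_3)
  then interpret t: tetrahedron ?S ?p ?q ?r ?s by blast
  have "realizes ?S ((4, 4, 1, 0), Some Paw_P)"
    by (rule t.realizes_4_4_1_0_P; unfold t.activity obtuse_def) (use * in \<open>simp_all add: inner_vec_def sum_3 vector_3\<close>)
  then show ?thesis using t.generic by blast
qed

text \<open>A polygonal path p, q, r, s with obtuse angles at its inner vertices.\<close>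

lemma example_4_3_0_0_L: "\<exists>S. generic S \<and> realizes S ((4, 3, 0, 0), Some Path_L)"
proof -
  note ex = coordinate_tetrahedron[where a = "1" and c = "1" and g = "1" and b = "2" and e = "2" and f = "2" and x = "1/2" and y = "3/2" and z = "1/2" and l\<^sub>1 = "3/2" and l\<^sub>2 = "-3/2" and l\<^sub>3 = "1/2" and l\<^sub>4 = "1/2"]
  let ?p = "0 :: point" and ?q = "vector [1, 0, 0] :: point" and ?r = "vector [2, 1, 0] :: point" and ?s = "vector [2, 2, 1] :: point"
  let ?S = "{?p, ?q, ?r, ?s}"
  have *: "tetrahedron ?S ?p ?q ?r ?s \<and> bary ?S ?p = 3/2 \<and> bary ?S ?q = -3/2 \<and> bary ?S ?r = 1/2 \<and> bary ?S ?s = 1/2"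
    by (rule ex) (auto simp: inner_vec_def sum_3 vector_3)
  then interpret t: tetrahedron ?S ?p ?q ?r ?s by blast
  have "realizes ?S ((4, 3, 0, 0), Some Path_L)"
    by (rule t.realizes_4_3_0_0_L; unfold t.activity obtuse_def) (use * in \<open>simp_all add: inner_vec_def sum_3 vector_3\<close>)
  then show ?thesis using t.generic by blast
qed

text \<open>The vectors from p to the other points have pairwise inner product -1, so all angles at
  p are obtuse.\<close>

lemma example_4_3_0_0_T: "\<exists>S. generic S \<and> realizes S ((4, 3, 0, 0), Some Star_T)"
proof -
  note ex = coordinate_tetrahedron[where a = "1" and c = "1" and g = "1" and b = "-1" and e = "-1" and f = "-2" and x = "1/2" and y = "3/2" and z = "13/2" and l\<^sub>1 = "-83/2" and l\<^sub>2 = "43/2" and l\<^sub>3 = "29/2" and l\<^sub>4 = "13/2"]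
  let ?p = "0 :: point" and ?q = "vector [1, 0, 0] :: point" and ?r = "vector [-1, 1, 0] :: point" and ?s = "vector [-1, -2, 1] :: point"
  let ?S = "{?p, ?q, ?r, ?s}"
  have *: "tetrahedron ?S ?p ?q ?r ?s \<and> bary ?S ?p = -83/2 \<and> bary ?S ?q = 43/2 \<and> bary ?S ?r = 29/2 \<and> bary ?S ?s = 13/2"
    by (rule ex) (auto simp: inner_vec_def sum_3 vector_3)
  then interpret t: tetrahedron ?S ?p ?q ?r ?s by blast
  have "realizes ?S ((4, 3, 0, 0), Some Star_T)"
    by (rule t.realizes_4_3_0_0_T; unfold t.activity obtuse_def) (use * in \<open>simp_all add: inner_vec_def sum_3 vector_3\<close>)
  then show ?thesis using t.generic by blast
qed

section \<open>The classification theorem\<close>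

lemma realizes_cong:
  assumes "combinatorially_equivalent S S'" "realizes S \<tau>"
  shows "realizes S' \<tau>"
proof -
  obtain M where "(\<tau>, M) \<in> models" "has_model S M" using assms(2) unfolding realizes_def by blast
  then show ?thesis
    using combinatorially_equivalent_iff[OF _ model_faces] assms(1) unfolding realizes_def by blast
qed

lemma realizes_nine_types: "realizes S \<tau> \<Longrightarrow> \<tau> \<in> nine_types"
  unfolding realizes_def fst_models[symmetric] by force

lemma realizes_exists:
  assumes "generic S"
  obtains \<tau> where "realizes S \<tau>"
proof -
  have "card S = 4" using assms by (simp add: generic_def)
  then obtain p q r s where "S = {p, q, r, s}"
    by (auto simp: numeral_eq_Suc card_Suc_eq)
  then interpret tetrahedron S p q r s using assms by unfold_locales
  show ?thesis using classification that by blast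
qed

text \<open>Some type is realized, a realized type is a type, and types are unique.\<close>

lemma has_type_iff_realizes:
  assumes "generic S"
  shows "has_type S \<tau> \<longleftrightarrow> realizes S \<tau>"
  using realizes_exists[OF assms] realizes_has_type[OF assms] has_type_unique by metis

lemma equivalent_iff_same_type:
  assumes "generic S" "generic S'"
  shows "combinatorially_equivalent S S' \<longleftrightarrow> (\<exists>\<tau>. has_type S \<tau> \<and> has_type S' \<tau>)"
proof
  assume "combinatorially_equivalent S S'"
  moreover obtain \<tau> where "realizes S \<tau>" using realizes_exists[OF assms(1)] .
  ultimately show "\<exists>\<tau>. has_type S \<tau> \<and> has_type S' \<tau>"
    using realizes_cong has_type_iff_realizes assms by blast
next
  assume "\<exists>\<tau>. has_type S \<tau> \<and> has_type S' \<tau>"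
  then obtain \<tau> M M' where "(\<tau>, M) \<in> models" "has_model S M" "(\<tau>, M') \<in> models" "has_model S' M'"
    unfolding has_type_iff_realizes[OF assms(1)] has_type_iff_realizes[OF assms(2)] realizes_def by blast
  then show "combinatorially_equivalent S S'"
    using models_functional combinatorially_equivalent_iff model_faces by metis
qed

lemma nine_types_realized:
  assumes "\<tau> \<in> nine_types"
  shows "\<exists>S. generic S \<and> has_type S \<tau>"
proof -
  have "\<exists>S. generic S \<and> realizes S \<tau>"
    using assms example_4_6_4_1 example_4_6_3_0 example_4_5_3_1 example_4_5_2_0 example_4_4_2_1_O
      example_4_4_1_0_O example_4_4_1_0_P example_4_3_0_0_L example_4_3_0_0_T
    unfolding nine_types_def by (elim insertE emptyE) simp_all
  then show ?thesis using has_type_iff_realizes by blast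
qed

lemma card_nine_types: "card nine_types = 9"
  unfolding nine_types_def by simp

theorem theorem4p1:
  "card ({S. generic S} //
      {(S, S'). generic S \<and> generic S' \<and> combinatorially_equivalent S S'}) = 9 \<and>
   (\<forall>S. generic S \<longrightarrow> (\<exists>!\<tau>. \<tau> \<in> nine_types \<and> has_type S \<tau>)) \<and>
   (\<forall>\<tau>\<in>nine_types. \<exists>S. generic S \<and> has_type S \<tau>) \<and>
   (\<forall>S S'. generic S \<and> generic S' \<longrightarrow>
      (combinatorially_equivalent S S' \<longleftrightarrow> (\<exists>\<tau>. has_type S \<tau> \<and> has_type S' \<tau>)))"
proof -
  let ?R = "{(S, S'). generic S \<and> generic S' \<and> combinatorially_equivalent S S'}"
  let ?C = "\<lambda>\<tau>. {S. generic S \<and> has_type S \<tau>}"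
  have type: "\<exists>\<tau>. \<tau> \<in> nine_types \<and> has_type S \<tau>" if "generic S" for S
    using realizes_exists[OF that] realizes_nine_types has_type_iff_realizes[OF that] by metis
  \<comment> \<open>The class of a quadruple consists of all generic quadruples of its type, so
    counting classes means counting types.\<close>
  have R: "?R `` {S} = ?C \<tau>" if "generic S" "has_type S \<tau>" for S \<tau>
    using that equivalent_iff_same_type has_type_unique by blast
  have "{S. generic S} // ?R = ?C ` nine_types"
  proof
    show "{S. generic S} // ?R \<subseteq> ?C ` nine_types"
    proof
      fix X assume "X \<in> {S. generic S} // ?R"
      then obtain S where S: "generic S" "X = ?R `` {S}" by (auto simp: quotient_def)
      obtain \<tau> where \<tau>: "\<tau> \<in> nine_types" "has_type S \<tau>" using type[OF S(1)] by blast
      show "X \<in> ?C ` nine_types" unfolding S(2) R[OF S(1) \<tau>(2)] using \<tau>(1) by (rule imageI)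
    qed
    show "?C ` nine_types \<subseteq> {S. generic S} // ?R"
    proof
      fix X assume "X \<in> ?C ` nine_types"
      then obtain \<tau> where "\<tau> \<in> nine_types" "X = ?C \<tau>" by blast
      moreover obtain S where "generic S" "has_type S \<tau>"
        using nine_types_realized[OF \<open>\<tau> \<in> nine_types\<close>] by blast
      ultimately show "X \<in> {S. generic S} // ?R"
        using R[of S \<tau>] quotientI[of S "{S. generic S}" ?R] by simp
    qed
  qed
  \<comment> \<open>The classes of the types are nonempty, and a common member has only one
    type.\<close>
  moreover have "inj_on ?C nine_types"
  proof (rule inj_onI)
    fix \<tau> \<tau>' assume "\<tau> \<in> nine_types" and eq: "?C \<tau> = ?C \<tau>'"
    then obtain S where "S \<in> ?C \<tau>" using nine_types_realized by blast
    then have "S \<in> ?C \<tau>'" unfolding eq .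
    then show "\<tau> = \<tau>'" using \<open>S \<in> ?C \<tau>\<close> has_type_unique by blast
  qed
  ultimately have "card ({S. generic S} // ?R) = 9"
    by (simp add: card_image card_nine_types)
  moreover have "\<exists>!\<tau>. \<tau> \<in> nine_types \<and> has_type S \<tau>" if "generic S" for S
    using type[OF that] has_type_unique by blast
  ultimately show ?thesis
    using nine_types_realized equivalent_iff_same_type by blast
qed

end
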